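(* Let $\alpha,\beta\in\mathbb{R}_{>0}$. The set $\{f\in\mathbb{R}[[x]]^{\alpha}_{\beta} : f_0=0,\ f_1=1\}$, with composition of power series as group operation, is a subgroup of the group $(\{f\in\mathbb{R}[[x]]: f_0=0,\ f_1=1\},\circ)$ of formal diffeomorphisms tangent to the identity. Moreover, if $f,g\in\mathbb{R}[[x]]^{\alpha}_{\beta}$ with $g_0=0$ and $g_1=1$, then $f\circ g\in\mathbb{R}[[x]]^{\alpha}_{\beta}$, $g^{-1}\in\mathbb{R}[[x]]^{\alpha}_{\beta}$, and $$(\mathcal{A}^\alpha_\beta (f\circ g))(x) = f'(g(x))\,(\mathcal{A}^\alpha_\beta g)(x) + \left(\frac{x}{g(x)}\right)^{\beta} e^{\frac{g(x)-x}{\alpha x g(x)}}\,(\mathcal{A}^\alpha_\beta f)(g(x)),$$ $$(\mathcal{A}^\alpha_\beta g^{-1})(x) = -{g^{-1}}'(x)\left(\frac{x}{g^{-1}(x)}\right)^{\beta} e^{\frac{g^{-1}(x)-x}{\alpha x g^{-1}(x)}}\,(\mathcal{A}^\alpha_\beta g)(g^{-1}(x)).$$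
   Context: For a formal power series $f(x)=\sum_{n\ge0}f_nx^n\in\mathbb{R}[[x]]$, $f_n=[x^n]f(x)$ and $f'$ is the formal derivative. For sequences, $b_n\in O(a_n)$ means $\limsup_{n\to\infty}|b_n/a_n|<\infty$. For $\alpha,\beta\in\mathbb{R}_{>0}$, $\mathbb{R}[[x]]^{\alpha}_{\beta}$ denotes the set of $f\in\mathbb{R}[[x]]$ for which there exists a real sequence $(c_k)_{k\ge0}$ with $f_n=\sum_{k=0}^{R-1}c_k\alpha^{n+\beta-k}\Gamma(n+\beta-k)+O(\alpha^n\Gamma(n+\beta-R))$ as $n\to\infty$ for every $R\in\mathbb{N}_0$; such a sequence is uniquely determined by $f$. The map $\mathcal{A}^\alpha_\beta:\mathbb{R}[[x]]^{\alpha}_{\beta}\to\mathbb{R}[[x]]$ sends $f$ to $\sum_{k\ge0}c_kx^k$. Here $f\circ g$ denotes $f(g(x))$, $g^{-1}$ the compositional inverse of $g$; real powers such as $(x/g(x))^\beta$ and exponentials of power series with well-defined constant term are understood as formal power series (note that $(g(x)-x)/(xg(x))$ is a formal power series since $g=x+O(x^2)$). *)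

theory Defs
  imports
    "HOL-Analysis.Gamma_Function"
    "HOL-Library.Landau_Symbols"
    "HOL-Computational_Algebra.Formal_Power_Series"
    "HOL-Algebra.Group"
begin

unbundle fps_syntax

definition has_fact_expansion :: "real \<Rightarrow> real \<Rightarrow> real fps \<Rightarrow> (nat \<Rightarrow> real) \<Rightarrow> bool" where
  "has_fact_expansion \<alpha> \<beta> f c \<longleftrightarrow>
     (\<forall>R. (\<lambda>n. f $ n - (\<Sum>k<R. c k * \<alpha> powr (real n + \<beta> - real k) * Gamma (real n + \<beta> - real k)))
        \<in> O(\<lambda>n. \<alpha> ^ n * Gamma (real n + \<beta> - real R)))"

definition fact_div_fps :: "real \<Rightarrow> real \<Rightarrow> real fps set" where
  "fact_div_fps \<alpha> \<beta> = {f. \<exists>c. has_fact_expansion \<alpha> \<beta> f c}"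

text \<open>Only meaningful on \<^term>\<open>fact_div_fps \<alpha> \<beta>\<close>; there the sequence exists by definition and is
  unique by \<open>has_fact_expansion_unique\<close> below.\<close>

definition asymp_deriv :: "real \<Rightarrow> real \<Rightarrow> real fps \<Rightarrow> real fps" where
  "asymp_deriv \<alpha> \<beta> f = Abs_fps (THE c. has_fact_expansion \<alpha> \<beta> f c)"

text \<open>The real power \<open>h\<^sup>b = (1 + (h - 1))\<^sup>b\<close> as a binomial series, for \<open>h\<close> with constant term 1.\<close>

definition fps_real_power :: "real fps \<Rightarrow> real \<Rightarrow> real fps" where
  "fps_real_power h b = fps_binomial b oo (h - 1)"

text \<open>The constant term of \<open>h\<close> is arbitrary and is split off, since \<^const>\<open>fps_compose\<close> is
  substitution only for inner series with vanishing constant term.\<close>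

definition fps_exp_of :: "real fps \<Rightarrow> real fps" where
  "fps_exp_of h = fps_const (exp (h $ 0)) * (fps_exp 1 oo (h - fps_const (h $ 0)))"

definition tangent_id_diffeos :: "real fps monoid" where
  "tangent_id_diffeos =
     \<lparr>carrier = {f. f $ 0 = 0 \<and> f $ 1 = 1}, mult = (\<lambda>f g. f oo g), one = fps_X\<rparr>"

lemma has_fact_expansion_unique:
  assumes "\<alpha> > 0" and c: "has_fact_expansion \<alpha> \<beta> f c" and d: "has_fact_expansion \<alpha> \<beta> f d"
  shows "c = d"
proof (rule ccontr)
  assume "c \<noteq> d"
  define k where "k = (LEAST k. c k \<noteq> d k)"
  have k: "c k \<noteq> d k" unfolding k_def by (rule LeastI_ex) (use \<open>c \<noteq> d\<close> in auto)
  have less: "c i = d i" if "i < k" for i using not_less_Least[of i] that unfolding k_def by blast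
  define T where "T = (\<lambda>n i. \<alpha> powr (real n + \<beta> - real i) * Gamma (real n + \<beta> - real i))"
  have "(\<lambda>n. (f $ n - (\<Sum>i<Suc k. c i * \<alpha> powr (real n + \<beta> - real i) * Gamma (real n + \<beta> - real i)))
           - (f $ n - (\<Sum>i<Suc k. d i * \<alpha> powr (real n + \<beta> - real i) * Gamma (real n + \<beta> - real i))))
        \<in> O(\<lambda>n. \<alpha> ^ n * Gamma (real n + \<beta> - real (Suc k)))"
    by (rule sum_in_bigo(2)[OF c[unfolded has_fact_expansion_def, rule_format, of "Suc k"]
          d[unfolded has_fact_expansion_def, rule_format, of "Suc k"]])
  also have "(\<lambda>n. (f $ n - (\<Sum>i<Suc k. c i * \<alpha> powr (real n + \<beta> - real i) * Gamma (real n + \<beta> - real i)))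
           - (f $ n - (\<Sum>i<Suc k. d i * \<alpha> powr (real n + \<beta> - real i) * Gamma (real n + \<beta> - real i))))
        = (\<lambda>n. (d k - c k) * T n k)"
    by (auto simp: T_def less algebra_simps)
  finally obtain C where C: "\<forall>\<^sub>F n in at_top. norm ((d k - c k) * T n k)
        \<le> C * norm (\<alpha> ^ n * Gamma (real n + \<beta> - real (Suc k)))"
    by (elim landau_o.bigE) auto
  define D where "D = \<bar>d k - c k\<bar> * \<alpha> powr (\<beta> - real k)"
  have "D > 0" using k \<open>\<alpha> > 0\<close> by (simp add: D_def)
  have "filterlim (\<lambda>n. real n) at_top sequentially" by (rule filterlim_real_sequentially)
  then have "\<forall>\<^sub>F n in sequentially. real n > max (C / D + 1 + real k - \<beta>) (1 + real k - \<beta>)"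
    by (rule filterlim_at_top_dense[THEN iffD1, rule_format])
  with C have "\<forall>\<^sub>F n::nat in sequentially. False"
  proof eventually_elim
    case (elim n)
    define y where "y = real n + \<beta> - real (Suc k)"
    have y: "y > 0" "y > C / D" using elim(2) by (auto simp: y_def)
    have G: "Gamma y > 0" using y(1) by (rule Gamma_real_pos)
    have eq: "real n + \<beta> - real k = y + 1" by (simp add: y_def)
    have ynp: "y \<notin> \<int>\<^sub>\<le>\<^sub>0" using y(1) by (auto elim!: nonpos_Ints_cases)
    have Gp: "Gamma (y + 1) = y * Gamma y" by (rule Gamma_plus1[OF ynp])
    have P: "\<alpha> powr (y + 1) = \<alpha> ^ n * \<alpha> powr (\<beta> - real k)"
    proof -
      have "y + 1 = real n + (\<beta> - real k)" by (simp add: y_def)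
      then show ?thesis using \<open>\<alpha> > 0\<close> by (simp add: powr_add powr_realpow)
    qed
    have "norm ((d k - c k) * T n k) = D * y * (\<alpha> ^ n * Gamma y)"
      unfolding T_def eq Gp P D_def using \<open>\<alpha> > 0\<close> G y(1) by (simp add: abs_mult)
    moreover have "norm (\<alpha> ^ n * Gamma (real n + \<beta> - real (Suc k))) = \<alpha> ^ n * Gamma y"
      unfolding y_def[symmetric] using \<open>\<alpha> > 0\<close> G by (simp add: abs_mult)
    ultimately have "D * y * (\<alpha> ^ n * Gamma y) \<le> C * (\<alpha> ^ n * Gamma y)" using elim(1) by simp
    moreover have "\<alpha> ^ n * Gamma y > 0" using \<open>\<alpha> > 0\<close> G by simp
    ultimately have "D * y \<le> C" by (rule mult_right_le_imp_le)
    then show False using y(2) \<open>D > 0\<close> by (simp add: field_simps)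
  qed
  then show False by simp
qed

end

theory Submission
  imports Defs
begin

text \<open>
  Write \<open>w\<^sub>n = \<alpha>\<^sup>n \<Gamma>(n + \<beta>)\<close> and \<open>G = \<alpha>\<^sup>\<beta> \<Sum> w\<^sub>n x\<^sup>n\<close>. A series \<open>f\<close> has the expansion \<open>c\<close> iff for every \<open>R\<close> it
  differs from \<open>(c mod x\<^sup>R) G\<close> by an element of a remainder space that is \<open>x\<^sup>R\<close> times the series bounded by \<open>w\<close>,
  up to polynomials. Log-convexity of \<open>w\<close> makes the bounded series a ring, and \<open>f \<mapsto> c\<close> a derivation.

  Hence composition with \<open>g\<close> only has to be understood for \<open>G\<close>. Write \<open>g = h \<circ> \<mu>\<close> with
  \<open>\<mu> = x / (1 - a x)\<close> and \<open>h = x + O(x\<^sup>3)\<close>. The coefficients of \<open>(1 - a x)\<^sup>-\<^sup>\<beta> (G \<circ> \<mu>)\<close> are those of \<open>G\<close>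
  times partial sums of \<open>exp (a / \<alpha>)\<close>, and for \<open>h\<close> the Taylor series of \<open>G(x + (h - x))\<close> is an asymptotic
  expansion. So \<open>G \<circ> g\<close> has an expansion with an explicit leading coefficient. The differential equation of \<open>G\<close>
  turns into a linear first order equation for this expansion, whose solution is the stated formula.

  For the inverse \<open>k\<close> of \<open>h\<close>, a bound on the coefficients follows by induction from \<open>k \<circ> h = x\<close>. If \<open>k\<^sub>R\<close> is the
  expansion of \<open>k\<close> predicted by the chain rule, then \<open>(k - k\<^sub>R) \<circ> h\<close> is in the remainder space, hence so is
  \<open>k - k\<^sub>R\<close>.
\<close>

unbundle no vec_syntax

section \<open>Factorial weights\<close>

definition wt :: "real \<Rightarrow> real \<Rightarrow> nat \<Rightarrow> real" where
  "wt \<alpha> \<beta> n = \<alpha> ^ n * Gamma (real n + \<beta>)"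

lemma wt_pos [simp]: "\<alpha> > 0 \<Longrightarrow> \<beta> > 0 \<Longrightarrow> wt \<alpha> \<beta> n > 0"
  by (simp add: wt_def Gamma_real_pos add_nonneg_pos)

lemma wt_nonneg [simp]: "\<alpha> > 0 \<Longrightarrow> \<beta> > 0 \<Longrightarrow> wt \<alpha> \<beta> n \<ge> 0"
  using wt_pos less_imp_le by blast

lemma wt_Suc:
  assumes "\<beta> > 0"
  shows "wt \<alpha> \<beta> (Suc n) = \<alpha> * (real n + \<beta>) * wt \<alpha> \<beta> n"
proof -
  have "real n + \<beta> \<notin> \<int>\<^sub>\<le>\<^sub>0"
    using assms by (auto elim!: nonpos_Ints_cases)
  from Gamma_plus1[OF this] show ?thesis
    by (simp add: wt_def algebra_simps)
qed

text \<open>Shifting the index by \<open>k\<close> amounts to raising \<beta> by \<open>k\<close>,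
  up to a constant. Division by a power of x can therefore be traded for a larger \<beta>.\<close>

lemma wt_add: "wt \<alpha> \<beta> (n + k) = \<alpha> ^ k * wt \<alpha> (\<beta> + real k) n"
  by (simp add: wt_def power_add algebra_simps)

text \<open>The ratio of consecutive weights, \<alpha> (n + \<beta>), increases with n, so moving
  index from the smaller factor to the larger one can only increase the product.\<close>

lemma wt_log_convex:
  assumes "\<alpha> > 0" "\<beta> > 0" "i \<le> a" "i \<le> b"
  shows "wt \<alpha> \<beta> a * wt \<alpha> \<beta> b \<le> wt \<alpha> \<beta> i * wt \<alpha> \<beta> (a + b - i)"
proof -
  have "wt \<alpha> \<beta> (i + d) * wt \<alpha> \<beta> b \<le> wt \<alpha> \<beta> i * wt \<alpha> \<beta> (b + d)" for d
  proof (induction d)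
    case (Suc d)
    have "wt \<alpha> \<beta> (i + Suc d) * wt \<alpha> \<beta> b
        = (\<alpha> * (real (i + d) + \<beta>)) * (wt \<alpha> \<beta> (i + d) * wt \<alpha> \<beta> b)"
      using assms by (simp add: wt_Suc)
    also have "\<dots> \<le> (\<alpha> * (real (b + d) + \<beta>)) * (wt \<alpha> \<beta> i * wt \<alpha> \<beta> (b + d))"
      using assms Suc by (intro mult_mono[OF _ Suc]) auto
    also have "\<dots> = wt \<alpha> \<beta> i * wt \<alpha> \<beta> (b + Suc d)"
      using assms by (simp add: wt_Suc)
    finally show ?case .
  qed simp
  from this[of "a - i"] assms show ?thesis
    by (simp add: add.commute)
qed

lemma of_nat_mult_wt_le:
  assumes "\<alpha> > 0" "\<beta> > 0"
  shows "real n * wt \<alpha> \<beta> n \<le> wt \<alpha> \<beta> (Suc n) / \<alpha>"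
  using assms by (simp add: wt_Suc field_simps)

text \<open>The two end terms give 2 w(r) w(n + r). By log-convexity each of the n - 1 inner terms
  is at most w(r + 1) w(n + r - 1), and the factor n - 1 is paid for by passing to w(n + r). The
  offset \<open>r\<close> serves series divisible by x^r.\<close>

lemma wt_convolution:
  assumes "\<alpha> > 0" "\<beta> > 0"
  obtains D where "D \<ge> 0"
    "\<And>n. (\<Sum>i\<le>n. wt \<alpha> \<beta> (i + r) * wt \<alpha> \<beta> (n - i + r)) \<le> D * wt \<alpha> \<beta> (n + r)"
proof
  let ?w = "wt \<alpha> \<beta>"
  let ?D = "2 * ?w r + ?w (Suc r) / \<alpha>"
  show "?D \<ge> 0" using assms by (simp add: less_imp_le)
  fix n
  show "(\<Sum>i\<le>n. ?w (i + r) * ?w (n - i + r)) \<le> ?D * ?w (n + r)"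
  proof (cases n)
    case 0
    have "?w r * ?w r \<ge> 0" "?w (Suc r) * ?w r / \<alpha> \<ge> 0" using assms by simp_all
    then show ?thesis using 0 by (simp add: algebra_simps)
  next
    case (Suc m)
    have "(\<Sum>i\<le>n. ?w (i + r) * ?w (n - i + r))
        = ?w r * ?w (n + r) + (\<Sum>i=1..m. ?w (i + r) * ?w (n - i + r)) + ?w (n + r) * ?w r"
    proof -
      have "{..n} = insert 0 (insert n {1..m})" using Suc by auto
      then show ?thesis using Suc by simp
    qed
    also have "(\<Sum>i=1..m. ?w (i + r) * ?w (n - i + r)) \<le> (\<Sum>i=1..m. ?w (Suc r) * ?w (m + r))"
    proof (rule sum_mono)
      fix i assume i: "i \<in> {1..m}"
      have "i + r + (n - i + r) - Suc r = m + r" using i Suc by simp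
      moreover have "Suc r \<le> i + r" "Suc r \<le> n - i + r" using i Suc by auto
      ultimately show "?w (i + r) * ?w (n - i + r) \<le> ?w (Suc r) * ?w (m + r)"
        using wt_log_convex[OF assms, of "Suc r" "i + r" "n - i + r"] by simp
    qed
    also have "\<dots> = ?w (Suc r) * (real m * ?w (m + r))" by simp
    also have "\<dots> \<le> ?w (Suc r) * (?w (n + r) / \<alpha>)"
    proof (rule mult_left_mono)
      have "real m * ?w (m + r) \<le> real (m + r) * ?w (m + r)"
        using assms by (intro mult_right_mono) auto
      also have "\<dots> \<le> ?w (n + r) / \<alpha>"
        using of_nat_mult_wt_le[OF assms, of "m + r"] Suc by simp
      finally show "real m * ?w (m + r) \<le> ?w (n + r) / \<alpha>" .
    qed (use assms in simp)
    finally show ?thesis by (simp add: algebra_simps)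
  qed
qed

text \<open>Once \<alpha> (n + \<beta>) exceeds \<rho>, the quotient of \<rho>^n by the weight
  decreases, so it is bounded by its maximum over an initial segment.\<close>

lemma power_le_wt:
  fixes \<rho> :: real
  assumes "\<alpha> > 0" "\<beta> > 0" "\<rho> > 0"
  obtains C where "C > 0" "\<And>n. \<rho> ^ n \<le> C * wt \<alpha> \<beta> n"
proof -
  let ?w = "wt \<alpha> \<beta>"
  obtain N where N: "real N \<ge> \<rho> / \<alpha>" using real_arch_simple by blast
  define C where "C = Max ((\<lambda>n. \<rho> ^ n / ?w n) ` {..N})"
  have le: "\<rho> ^ n / ?w n \<le> C" for n
  proof (cases "n \<le> N")
    case True
    then show ?thesis unfolding C_def by (intro Max_ge) auto
  next
    case False
    have "\<rho> ^ n / ?w n \<le> \<rho> ^ N / ?w N"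
    proof (rule dec_induct[of N n])
      show "N \<le> n" using False by simp
      fix m assume m: "N \<le> m" and IH: "\<rho> ^ m / ?w m \<le> \<rho> ^ N / ?w N"
      have "\<rho> / \<alpha> \<le> real m + \<beta>" using N m assms(2) by linarith
      then have "\<rho> \<le> \<alpha> * (real m + \<beta>)" using assms by (simp add: field_simps)
      moreover have "\<alpha> * (real m + \<beta>) > 0" using assms by (simp add: add_nonneg_pos)
      ultimately have "\<rho> / (\<alpha> * (real m + \<beta>)) \<le> 1" by simp
      moreover have "\<rho> ^ Suc m / ?w (Suc m) = \<rho> / (\<alpha> * (real m + \<beta>)) * (\<rho> ^ m / ?w m)"
        using assms by (simp add: wt_Suc)
      moreover have "\<rho> ^ m / ?w m \<ge> 0" using assms by simp
      ultimately have "\<rho> ^ Suc m / ?w (Suc m) \<le> \<rho> ^ m / ?w m"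
        by (simp only: mult_le_cancel_right1) (use mult_right_mono in fastforce)
      then show "\<rho> ^ Suc m / ?w (Suc m) \<le> \<rho> ^ N / ?w N" using IH by linarith
    qed simp
    also have "\<dots> \<le> C" unfolding C_def by (intro Max_ge) auto
    finally show ?thesis .
  qed
  show ?thesis
  proof
    show "C > 0"
    proof -
      have "0 < \<rho> ^ 0 / ?w 0" using assms by simp
      then show ?thesis using le[of 0] by linarith
    qed
    show "\<rho> ^ n \<le> C * ?w n" for n using le[of n] assms by (simp add: divide_le_eq)
  qed
qed

text \<open>The weights may decrease at first, hence the constant. It comes from log-convexity at
  index 0 together with a positive lower bound for all weights.\<close>

lemma wt_quasi_mono:
  assumes "\<alpha> > 0" "\<beta> > 0"
  obtains C where "C > 0" "\<And>i n. i \<le> n \<Longrightarrow> wt \<alpha> \<beta> i \<le> C * wt \<alpha> \<beta> n"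
proof -
  let ?w = "wt \<alpha> \<beta>"
  obtain C where C: "C > 0" "\<And>n. 1 \<le> C * ?w n"
    using power_le_wt[OF assms zero_less_one] by auto
  show ?thesis
  proof
    show "C * ?w 0 > 0" using C assms by simp
    fix i n :: nat assume "i \<le> n"
    have "?w i \<le> ?w i * (C * ?w (n - i))"
      using mult_left_mono[OF C(2)[of "n - i"], of "?w i"] assms by simp
    also have "\<dots> \<le> C * (?w 0 * ?w n)"
      using wt_log_convex[OF assms, of 0 i "n - i"] \<open>i \<le> n\<close> C by simp
    finally show "?w i \<le> C * ?w 0 * ?w n" by (simp add: mult_ac)
  qed
qed

section \<open>Series bounded by the weights\<close>

definition wt_bounded :: "real \<Rightarrow> real \<Rightarrow> real fps set" where
  "wt_bounded \<alpha> \<beta> = {f. \<exists>C. \<forall>n. \<bar>f $ n\<bar> \<le> C * wt \<alpha> \<beta> n}"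

lemma wt_boundedI: "(\<And>n. \<bar>f $ n\<bar> \<le> C * wt \<alpha> \<beta> n) \<Longrightarrow> f \<in> wt_bounded \<alpha> \<beta>"
  by (auto simp: wt_bounded_def)

lemma wt_boundedE:
  assumes "f \<in> wt_bounded \<alpha> \<beta>" "\<alpha> > 0" "\<beta> > 0"
  obtains C where "C > 0" "\<And>n. \<bar>f $ n\<bar> \<le> C * wt \<alpha> \<beta> n"
proof -
  obtain C where C: "\<And>n. \<bar>f $ n\<bar> \<le> C * wt \<alpha> \<beta> n" using assms by (auto simp: wt_bounded_def)
  show ?thesis
  proof
    show "max C 1 > 0" by simp
    show "\<bar>f $ n\<bar> \<le> max C 1 * wt \<alpha> \<beta> n" for n
      by (rule order_trans[OF C]) (use assms in \<open>auto intro!: mult_right_mono\<close>)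
  qed
qed

lemma wt_boundedI_eventually:
  assumes "\<alpha> > 0" "\<beta> > 0" and le: "\<And>n. n \<ge> N \<Longrightarrow> \<bar>f $ n\<bar> \<le> C * wt \<alpha> \<beta> n"
  shows "f \<in> wt_bounded \<alpha> \<beta>"
proof (rule wt_boundedI)
  define C' where "C' = max C (Max ((\<lambda>n. \<bar>f $ n\<bar> / wt \<alpha> \<beta> n) ` {..N}))"
  fix n
  have "\<bar>f $ n\<bar> / wt \<alpha> \<beta> n \<le> C'"
  proof (cases "n \<le> N")
    case True
    then have "\<bar>f $ n\<bar> / wt \<alpha> \<beta> n \<le> Max ((\<lambda>n. \<bar>f $ n\<bar> / wt \<alpha> \<beta> n) ` {..N})"
      by (intro Max_ge) auto
    then show ?thesis by (simp add: C'_def)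
  next
    case False
    then have "\<bar>f $ n\<bar> / wt \<alpha> \<beta> n \<le> C"
      using le[of n] assms(1,2) by (simp add: divide_le_eq)
    then show ?thesis by (simp add: C'_def)
  qed
  then show "\<bar>f $ n\<bar> \<le> C' * wt \<alpha> \<beta> n"
    using assms(1,2) by (simp add: divide_le_eq)
qed

lemma wt_bounded_add:
  assumes "f \<in> wt_bounded \<alpha> \<beta>" "g \<in> wt_bounded \<alpha> \<beta>"
  shows "f + g \<in> wt_bounded \<alpha> \<beta>"
proof -
  obtain C D where CD: "\<And>n. \<bar>f $ n\<bar> \<le> C * wt \<alpha> \<beta> n" "\<And>n. \<bar>g $ n\<bar> \<le> D * wt \<alpha> \<beta> n"
    using assms by (auto simp: wt_bounded_def)
  show ?thesis
  proof (rule wt_boundedI)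
    show "\<bar>(f + g) $ n\<bar> \<le> (C + D) * wt \<alpha> \<beta> n" for n
      using CD(1)[of n] CD(2)[of n] abs_triangle_ineq[of "f $ n" "g $ n"] by (simp add: algebra_simps)
  qed
qed

lemma wt_bounded_uminus: "f \<in> wt_bounded \<alpha> \<beta> \<Longrightarrow> - f \<in> wt_bounded \<alpha> \<beta>"
  by (simp add: wt_bounded_def)

lemma wt_bounded_diff:
  "f \<in> wt_bounded \<alpha> \<beta> \<Longrightarrow> g \<in> wt_bounded \<alpha> \<beta> \<Longrightarrow> f - g \<in> wt_bounded \<alpha> \<beta>"
  using wt_bounded_add[of f \<alpha> \<beta> "- g"] wt_bounded_uminus by simp

lemma wt_bounded_mult:
  assumes "\<alpha> > 0" "\<beta> > 0" "f \<in> wt_bounded \<alpha> \<beta>" "g \<in> wt_bounded \<alpha> \<beta>"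
  shows "f * g \<in> wt_bounded \<alpha> \<beta>"
proof -
  obtain C where C: "C > 0" "\<And>n. \<bar>f $ n\<bar> \<le> C * wt \<alpha> \<beta> n" using assms wt_boundedE by metis
  obtain C' where C': "C' > 0" "\<And>n. \<bar>g $ n\<bar> \<le> C' * wt \<alpha> \<beta> n" using assms wt_boundedE by metis
  obtain D where D: "D \<ge> 0" "\<And>n. (\<Sum>i\<le>n. wt \<alpha> \<beta> i * wt \<alpha> \<beta> (n - i)) \<le> D * wt \<alpha> \<beta> n"
    using wt_convolution[OF assms(1,2), of 0] by auto
  show ?thesis
  proof (rule wt_boundedI)
    fix n
    have "\<bar>(f * g) $ n\<bar> \<le> (\<Sum>i\<le>n. \<bar>f $ i\<bar> * \<bar>g $ (n - i)\<bar>)"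
      unfolding fps_mult_nth atLeast0AtMost
      by (rule order_trans[OF sum_abs]) (simp add: abs_mult)
    also have "\<dots> \<le> (\<Sum>i\<le>n. (C * wt \<alpha> \<beta> i) * (C' * wt \<alpha> \<beta> (n - i)))"
      using C C' assms by (intro sum_mono mult_mono) auto
    also have "\<dots> = C * C' * (\<Sum>i\<le>n. wt \<alpha> \<beta> i * wt \<alpha> \<beta> (n - i))"
      by (simp add: sum_distrib_left mult_ac)
    also have "\<dots> \<le> C * C' * (D * wt \<alpha> \<beta> n)"
      using C C' D by (intro mult_left_mono) auto
    finally show "\<bar>(f * g) $ n\<bar> \<le> (C * C' * D) * wt \<alpha> \<beta> n" by (simp add: mult_ac)
  qed
qed

lemma wt_bounded_finite:
  assumes "\<alpha> > 0" "\<beta> > 0" "\<And>n. n \<ge> N \<Longrightarrow> f $ n = 0"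
  shows "f \<in> wt_bounded \<alpha> \<beta>"
  by (rule wt_boundedI_eventually[of _ _ N _ 0]) (use assms in auto)

lemma wt_bounded_one: "\<alpha> > 0 \<Longrightarrow> \<beta> > 0 \<Longrightarrow> 1 \<in> wt_bounded \<alpha> \<beta>"
  by (rule wt_bounded_finite[of _ _ 1]) auto

lemma wt_bounded_power:
  "\<alpha> > 0 \<Longrightarrow> \<beta> > 0 \<Longrightarrow> f \<in> wt_bounded \<alpha> \<beta> \<Longrightarrow> f ^ k \<in> wt_bounded \<alpha> \<beta>"
  by (induction k) (auto intro: wt_bounded_one wt_bounded_mult)

lemma wt_bounded_shift_iff:
  assumes "\<alpha> > 0" "\<beta> > 0"
  shows "fps_shift k f \<in> wt_bounded \<alpha> (\<beta> + real k) \<longleftrightarrow> f \<in> wt_bounded \<alpha> \<beta>"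
proof
  assume "f \<in> wt_bounded \<alpha> \<beta>"
  then obtain C where C: "\<And>n. \<bar>f $ n\<bar> \<le> C * wt \<alpha> \<beta> n" by (auto simp: wt_bounded_def)
  show "fps_shift k f \<in> wt_bounded \<alpha> (\<beta> + real k)"
  proof (rule wt_boundedI)
    show "\<bar>fps_shift k f $ n\<bar> \<le> C * \<alpha> ^ k * wt \<alpha> (\<beta> + real k) n" for n
      using C[of "n + k"] by (simp add: wt_add mult_ac)
  qed
next
  assume "fps_shift k f \<in> wt_bounded \<alpha> (\<beta> + real k)"
  then obtain C where C: "\<And>n. \<bar>f $ (n + k)\<bar> \<le> C * wt \<alpha> (\<beta> + real k) n"
    by (auto simp: wt_bounded_def)
  show "f \<in> wt_bounded \<alpha> \<beta>"
  proof (rule wt_boundedI_eventually[OF assms])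
    fix n assume "k \<le> n"
    then show "\<bar>f $ n\<bar> \<le> C / \<alpha> ^ k * wt \<alpha> \<beta> n"
      using C[of "n - k"] wt_add[of \<alpha> \<beta> "n - k" k] assms by simp
  qed
qed

lemma wt_bounded_X_power_mult_iff:
  assumes "\<alpha> > 0" "\<beta> > 0"
  shows "fps_X ^ k * f \<in> wt_bounded \<alpha> \<beta> \<longleftrightarrow> f \<in> wt_bounded \<alpha> (\<beta> + real k)"
proof -
  have "fps_shift k (fps_X ^ k * f) = f"
    by (simp add: fps_eq_iff fps_X_power_mult_nth)
  with wt_bounded_shift_iff[OF assms, of k "fps_X ^ k * f"] show ?thesis by simp
qed

text \<open>Multiplication by x^k stays inside the ring of bounded series, and cancelling x^k
  afterwards raises \<beta> by \<open>k\<close>. No Gamma values need to be compared.\<close>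

lemma wt_bounded_mono:
  assumes "\<alpha> > 0" "\<beta> > 0"
  shows "wt_bounded \<alpha> \<beta> \<subseteq> wt_bounded \<alpha> (\<beta> + real k)"
proof
  fix f assume f: "f \<in> wt_bounded \<alpha> \<beta>"
  have "fps_X ^ k \<in> wt_bounded \<alpha> \<beta>"
    using assms by (intro wt_bounded_finite[of _ _ "Suc k"]) auto
  with f have "fps_X ^ k * f \<in> wt_bounded \<alpha> \<beta>"
    using wt_bounded_mult assms by blast
  then show "f \<in> wt_bounded \<alpha> (\<beta> + real k)"
    using wt_bounded_X_power_mult_iff[OF assms] by simp
qed

section \<open>The remainder spaces\<close>

lemma fps_X_power_dvd_iff_nth: "fps_X ^ R dvd (f :: real fps) \<longleftrightarrow> (\<forall>i<R. f $ i = 0)"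
proof
  assume "fps_X ^ R dvd f"
  then show "\<forall>i<R. f $ i = 0" by (auto simp: fps_X_power_mult_nth elim!: dvdE)
next
  assume "\<forall>i<R. f $ i = 0"
  then have "fps_cutoff R f = 0" by (simp add: fps_eq_iff)
  then have "f = fps_X ^ R * fps_shift R f" using fps_shift_cutoff'[of R f] by simp
  then show "fps_X ^ R dvd f" by (rule dvdI)
qed

lemma fps_X_power_dvd_cutoff_diff: "fps_X ^ R dvd fps_cutoff R f - (f :: real fps)"
  by (simp add: fps_X_power_dvd_iff_nth)

section \<open>Polynomials, seen as power series with finitely many nonzero coefficients\<close>

definition fps_finite :: "real fps \<Rightarrow> bool" where
  "fps_finite p \<longleftrightarrow> (\<exists>N. p = fps_cutoff N p)"

lemma fps_finite_iff: "fps_finite p \<longleftrightarrow> (\<exists>N. \<forall>n\<ge>N. p $ n = 0)"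
  by (auto simp: fps_finite_def fps_eq_iff not_less)

lemma fps_finite_cutoff [simp]: "fps_finite (fps_cutoff N f)"
  by (auto simp: fps_finite_iff intro!: exI[of _ N])

lemma fps_finite_const [simp]: "fps_finite (fps_const c)"
  by (auto simp: fps_finite_iff intro!: exI[of _ 1])

lemma fps_finite_X [simp]: "fps_finite fps_X"
  by (auto simp: fps_finite_iff intro!: exI[of _ 2])

lemma fps_finite_add [simp]:
  assumes "fps_finite p" "fps_finite q" shows "fps_finite (p + q)"
proof -
  obtain M N where "\<forall>n\<ge>M. p $ n = 0" "\<forall>n\<ge>N. q $ n = 0" using assms by (auto simp: fps_finite_iff)
  then show ?thesis by (auto simp: fps_finite_iff intro!: exI[of _ "max M N"])
qed

lemma fps_finite_uminus [simp]: "fps_finite p \<Longrightarrow> fps_finite (- p)"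
  by (auto simp: fps_finite_iff)

lemma fps_finite_diff [simp]: "fps_finite p \<Longrightarrow> fps_finite q \<Longrightarrow> fps_finite (p - q)"
  using fps_finite_add[of p "- q"] by simp

lemma fps_finite_mult [simp]:
  assumes "fps_finite p" "fps_finite q" shows "fps_finite (p * q)"
proof -
  obtain M N where MN: "\<forall>n\<ge>M. p $ n = 0" "\<forall>n\<ge>N. q $ n = 0"
    using assms by (auto simp: fps_finite_iff)
  have "(p * q) $ n = 0" if "n \<ge> M + N" for n
  proof -
    have "p $ i * q $ (n - i) = 0" if "i \<in> {0..n}" for i
    proof (cases "i \<ge> M")
      case False
      then have "n - i \<ge> N" using \<open>n \<ge> M + N\<close> by simp
      then show ?thesis using MN by simp
    qed (use MN in simp)
    then show ?thesis unfolding fps_mult_nth by (rule sum.neutral[OF ballI])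
  qed
  then show ?thesis by (auto simp: fps_finite_iff)
qed

lemma fps_finite_power [simp]: "fps_finite p \<Longrightarrow> fps_finite (p ^ k)"
  by (induction k) (use fps_finite_const[of 1] in auto)

lemma fps_finite_deriv [simp]: "fps_finite p \<Longrightarrow> fps_finite (fps_deriv p)"
  by (auto simp: fps_finite_iff intro: le_SucI)

lemma fps_finite_shift [simp]: "fps_finite p \<Longrightarrow> fps_finite (fps_shift k p)"
  by (auto simp: fps_finite_iff intro: trans_le_add1)

text \<open>These are the series with n-th coefficient of order w(n - R) for n at least
  \<open>R\<close>; the first \<open>R\<close> coefficients are free, so every polynomial belongs to
  each of these spaces. Shifting keeps the argument of Gamma positive.\<close>

definition wt_small :: "real \<Rightarrow> real \<Rightarrow> nat \<Rightarrow> real fps set" where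
  "wt_small \<alpha> \<beta> R = {f. fps_shift R f \<in> wt_bounded \<alpha> \<beta>}"

lemma wt_small_0 [simp]: "wt_small \<alpha> \<beta> 0 = wt_bounded \<alpha> \<beta>"
  by (simp add: wt_small_def)

lemma wt_small_add: "f \<in> wt_small \<alpha> \<beta> R \<Longrightarrow> g \<in> wt_small \<alpha> \<beta> R \<Longrightarrow> f + g \<in> wt_small \<alpha> \<beta> R"
  by (simp add: wt_small_def fps_shift_add wt_bounded_add)

lemma wt_small_uminus: "f \<in> wt_small \<alpha> \<beta> R \<Longrightarrow> - f \<in> wt_small \<alpha> \<beta> R"
  by (simp add: wt_small_def fps_shift_uminus wt_bounded_uminus)

lemma wt_small_diff: "f \<in> wt_small \<alpha> \<beta> R \<Longrightarrow> g \<in> wt_small \<alpha> \<beta> R \<Longrightarrow> f - g \<in> wt_small \<alpha> \<beta> R"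
  using wt_small_add[of f \<alpha> \<beta> R "- g"] wt_small_uminus by simp

lemma wt_small_finite:
  assumes "\<alpha> > 0" "\<beta> > 0" "fps_finite p"
  shows "p \<in> wt_small \<alpha> \<beta> R"
proof -
  obtain N where "\<forall>n\<ge>N. p $ n = 0" using assms by (auto simp: fps_finite_iff)
  then show ?thesis unfolding wt_small_def mem_Collect_eq
    by (intro wt_bounded_finite[of _ _ N]) (use assms in auto)
qed

lemma wt_small_X_power_mult:
  "fps_X ^ k * f \<in> wt_small \<alpha> \<beta> (R + k) \<longleftrightarrow> f \<in> wt_small \<alpha> \<beta> R"
proof -
  have "fps_shift (R + k) (fps_X ^ k * f) = fps_shift R f"
    by (simp add: fps_eq_iff fps_X_power_mult_nth)
  then show ?thesis by (simp add: wt_small_def)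
qed

lemma wt_small_antimono:
  assumes "\<alpha> > 0" "\<beta> > 0" "R \<le> R'" "f \<in> wt_small \<alpha> \<beta> R'"
  shows "f \<in> wt_small \<alpha> \<beta> R"
proof -
  have "fps_shift (R' - R) (fps_shift R f) = fps_shift R' f"
    using assms(3) by (simp add: fps_eq_iff)
  moreover have "fps_shift R' f \<in> wt_bounded \<alpha> (\<beta> + real (R' - R))"
    using assms(4) wt_bounded_mono[OF assms(1,2)] unfolding wt_small_def by blast
  ultimately show ?thesis
    using wt_bounded_shift_iff[OF assms(1,2), of "R' - R" "fps_shift R f"] by (simp add: wt_small_def)
qed

lemma wt_small_const_mult:
  assumes "f \<in> wt_small \<alpha> \<beta> R"
  shows "fps_const c * f \<in> wt_small \<alpha> \<beta> R"
proof -
  obtain C where C: "\<And>n. \<bar>f $ (n + R)\<bar> \<le> C * wt \<alpha> \<beta> n"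
    using assms by (auto simp: wt_small_def wt_bounded_def)
  have "\<bar>fps_shift R (fps_const c * f) $ n\<bar> \<le> \<bar>c\<bar> * C * wt \<alpha> \<beta> n" for n
    using mult_left_mono[OF C[of n], of "\<bar>c\<bar>"] by (simp add: abs_mult mult_ac)
  then show ?thesis unfolding wt_small_def mem_Collect_eq by (rule wt_boundedI)
qed

lemma wt_small_finite_mult:
  assumes "\<alpha> > 0" "\<beta> > 0" "fps_finite p" "f \<in> wt_small \<alpha> \<beta> R"
  shows "p * f \<in> wt_small \<alpha> \<beta> R"
proof -
  have "fps_cutoff N p * f \<in> wt_small \<alpha> \<beta> R" for N
  proof (induction N)
    case 0
    then show ?case using wt_small_finite[OF assms(1,2), of 0] fps_finite_const[of 0] by simp
  next
    case (Suc N)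
    have "fps_cutoff (Suc N) p = fps_cutoff N p + fps_const (p $ N) * fps_X ^ N"
      by (auto simp: fps_eq_iff less_Suc_eq)
    then have "fps_cutoff (Suc N) p * f
        = fps_cutoff N p * f + fps_const (p $ N) * (fps_X ^ N * f)"
      by (simp add: algebra_simps)
    moreover have "fps_X ^ N * f \<in> wt_small \<alpha> \<beta> R"
      using assms wt_small_antimono[OF assms(1,2), of R "R + N"]
      by (simp add: wt_small_X_power_mult)
    ultimately show ?case using Suc by (simp add: wt_small_add wt_small_const_mult)
  qed
  then show ?thesis using assms(3) unfolding fps_finite_def by metis
qed

lemma wt_small_X_power_mult_iff:
  assumes "\<alpha> > 0" "\<beta> > 0"
  shows "fps_X ^ k * f \<in> wt_small \<alpha> \<beta> R \<longleftrightarrow> f \<in> wt_small \<alpha> (\<beta> + real k) R"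
proof -
  have "fps_shift k (fps_shift R (fps_X ^ k * f)) = fps_shift R f"
    by (simp add: fps_eq_iff fps_X_power_mult_nth)
  then show ?thesis
    using wt_bounded_shift_iff[OF assms, of k "fps_shift R (fps_X ^ k * f)"] by (simp add: wt_small_def)
qed

text \<open>Differentiation multiplies the n-th coefficient by n, which costs one index of the
  weights; the operator x^2 d/dx moves the index up by one and so compensates exactly.\<close>

lemma wt_small_X2_deriv:
  assumes "\<alpha> > 0" "\<beta> > 0" "f \<in> wt_small \<alpha> \<beta> R"
  shows "fps_X ^ 2 * fps_deriv f \<in> wt_small \<alpha> \<beta> R"
proof -
  obtain C where C: "C > 0" "\<And>n. \<bar>f $ (n + R)\<bar> \<le> C * wt \<alpha> \<beta> n"
    using assms(3) wt_boundedE[OF _ assms(1,2), of "fps_shift R f"] by (auto simp: wt_small_def)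
  \<comment> \<open>The factor 1 + R / \<beta> turns m + R into a multiple of m + \<beta>, and
    \<alpha> (m + \<beta>) is the ratio of consecutive weights.\<close>
  let ?K = "C * (1 + real R / \<beta>) / \<alpha>"
  show ?thesis unfolding wt_small_def mem_Collect_eq
  proof (rule wt_boundedI_eventually[OF assms(1,2)])
    fix n :: nat assume "2 \<le> n"
    then obtain m where m: "n = Suc m" "m \<ge> 1" by (cases n) auto
    have "\<bar>fps_shift R (fps_X ^ 2 * fps_deriv f) $ n\<bar> = real (m + R) * \<bar>f $ (m + R)\<bar>"
      using m by (simp add: fps_X_power_mult_nth abs_mult)
    also have "\<dots> \<le> real (m + R) * (C * wt \<alpha> \<beta> m)"
      by (intro mult_left_mono C) simp
    also have "\<dots> \<le> ((1 + real R / \<beta>) * (real m + \<beta>)) * (C * wt \<alpha> \<beta> m)"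
    proof (rule mult_right_mono)
      have "real R * real m / \<beta> + \<beta> \<ge> 0" using assms(1,2) by (intro add_nonneg_nonneg) auto
      then show "real (m + R) \<le> (1 + real R / \<beta>) * (real m + \<beta>)"
        using assms(1,2) by (simp add: distrib_left distrib_right)
    qed (use C assms in simp)
    also have "\<dots> = ?K * wt \<alpha> \<beta> n"
      using m assms by (simp add: wt_Suc)
    finally show "\<bar>fps_shift R (fps_X ^ 2 * fps_deriv f) $ n\<bar> \<le> ?K * wt \<alpha> \<beta> n" .
  qed
qed

text \<open>Up to a product of two polynomials the expression is the product of the two tails,
  x^(2R) f' g'. Both shifted tails are bounded at \<beta> + R; one factor x^R brings their product
  back to \<beta>, and the other gives the gain of order \<open>R\<close>.\<close>

lemma wt_bounded_mult_expand:
  assumes pos: "\<alpha> > 0" "\<beta> > 0" and fg: "f \<in> wt_bounded \<alpha> \<beta>" "g \<in> wt_bounded \<alpha> \<beta>"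
  shows "f * g - fps_cutoff R f * g - f * fps_cutoff R g \<in> wt_small \<alpha> \<beta> R"
proof -
  define f' where "f' = fps_shift R f"
  define g' where "g' = fps_shift R g"
  have f: "f = fps_X ^ R * f' + fps_cutoff R f" and g: "g = fps_X ^ R * g' + fps_cutoff R g"
    unfolding f'_def g'_def by (simp_all add: fps_shift_cutoff')
  have "f' \<in> wt_bounded \<alpha> (\<beta> + real R)" "g' \<in> wt_bounded \<alpha> (\<beta> + real R)"
    unfolding f'_def g'_def using fg wt_bounded_shift_iff[OF pos] by blast+
  then have "f' * g' \<in> wt_bounded \<alpha> (\<beta> + real R)"
    using pos by (intro wt_bounded_mult) auto
  then have "fps_X ^ R * (f' * g') \<in> wt_small \<alpha> \<beta> 0"
    using wt_bounded_X_power_mult_iff[OF pos] by simp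
  then have "fps_X ^ R * (fps_X ^ R * (f' * g')) \<in> wt_small \<alpha> \<beta> R"
    using wt_small_X_power_mult[of R _ \<alpha> \<beta> 0] by simp
  moreover have "fps_cutoff R f * fps_cutoff R g \<in> wt_small \<alpha> \<beta> R"
    using pos by (intro wt_small_finite) auto
  ultimately have "fps_X ^ R * (fps_X ^ R * (f' * g')) - fps_cutoff R f * fps_cutoff R g \<in> wt_small \<alpha> \<beta> R"
    by (rule wt_small_diff)
  also have "fps_X ^ R * (fps_X ^ R * (f' * g')) = (f - fps_cutoff R f) * (g - fps_cutoff R g)"
    by (subst f, subst g) (simp add: mult_ac)
  finally show ?thesis by (simp add: algebra_simps)
qed

section \<open>Factorial asymptotics in terms of remainder spaces\<close>

text \<open>This is the model series G with expansion 1. The factor \<alpha>^\<beta> reflects that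
  the k-th term of an expansion carries the real power of \<alpha> with exponent n + \<beta> -
  k.\<close>

definition wt_base :: "real \<Rightarrow> real \<Rightarrow> real fps" where
  "wt_base \<alpha> \<beta> = Abs_fps (\<lambda>n. \<alpha> powr \<beta> * wt \<alpha> \<beta> n)"

text \<open>Generating function form of the expansion: x^k G supplies the k-th term, so a truncated
  expansion is a polynomial multiple of G.\<close>

definition fact_asymp :: "real \<Rightarrow> real \<Rightarrow> real fps \<Rightarrow> real fps \<Rightarrow> bool" where
  "fact_asymp \<alpha> \<beta> f c \<longleftrightarrow> (\<forall>R. f - fps_cutoff R c * wt_base \<alpha> \<beta> \<in> wt_small \<alpha> \<beta> R)"

lemma wt_base_nth [simp]: "wt_base \<alpha> \<beta> $ n = \<alpha> powr \<beta> * wt \<alpha> \<beta> n"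
  by (simp add: wt_base_def)

lemma wt_base_bounded: "wt_base \<alpha> \<beta> \<in> wt_bounded \<alpha> \<beta>" if "\<alpha> > 0" "\<beta> > 0"
  by (rule wt_boundedI[of _ "\<alpha> powr \<beta>"]) (use that in \<open>simp add: abs_mult\<close>)

lemma finite_mult_wt_base_small:
  assumes "\<alpha> > 0" "\<beta> > 0" "fps_finite p" "fps_X ^ R dvd p"
  shows "p * wt_base \<alpha> \<beta> \<in> wt_small \<alpha> \<beta> R"
proof -
  obtain q where q: "p = fps_X ^ R * q" using assms by blast
  have "q = fps_shift R p" by (simp add: q fps_eq_iff fps_X_power_mult_nth)
  then have "fps_finite q" using assms by simp
  then have "q * wt_base \<alpha> \<beta> \<in> wt_small \<alpha> \<beta> 0"
    using assms wt_base_bounded by (intro wt_small_finite_mult) auto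
  then show ?thesis using wt_small_X_power_mult[of R _ \<alpha> \<beta> 0] by (simp add: q mult.assoc)
qed

text \<open>Any polynomial that agrees with \<open>c\<close> up to order \<open>R\<close> may
  replace the truncation of \<open>c\<close>, because a polynomial multiple of x^R, times G, already
  lies in the remainder space.\<close>

lemma fact_asympI:
  assumes pos: "\<alpha> > 0" "\<beta> > 0"
    and ex: "\<And>R. \<exists>p. fps_finite p \<and> fps_X ^ R dvd p - c \<and> f - p * wt_base \<alpha> \<beta> \<in> wt_small \<alpha> \<beta> R"
  shows "fact_asymp \<alpha> \<beta> f c"
  unfolding fact_asymp_def
proof
  fix R
  obtain p where p: "fps_finite p" "fps_X ^ R dvd p - c" "f - p * wt_base \<alpha> \<beta> \<in> wt_small \<alpha> \<beta> R"
    using ex by blast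
  have "fps_X ^ R dvd p - fps_cutoff R c"
    using dvd_diff[OF p(2) fps_X_power_dvd_cutoff_diff[of R c]] by simp
  then have "(p - fps_cutoff R c) * wt_base \<alpha> \<beta> \<in> wt_small \<alpha> \<beta> R"
    using p pos by (intro finite_mult_wt_base_small) auto
  from wt_small_add[OF p(3) this] show "f - fps_cutoff R c * wt_base \<alpha> \<beta> \<in> wt_small \<alpha> \<beta> R"
    by (simp add: algebra_simps)
qed

lemma fact_asympD: "fact_asymp \<alpha> \<beta> f c \<Longrightarrow> f - fps_cutoff R c * wt_base \<alpha> \<beta> \<in> wt_small \<alpha> \<beta> R"
  by (simp add: fact_asymp_def)

lemma fact_asymp_bounded: "fact_asymp \<alpha> \<beta> f c \<Longrightarrow> f \<in> wt_bounded \<alpha> \<beta>"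
  using fact_asympD[of \<alpha> \<beta> f c 0] by simp

lemma fact_asymp_add:
  assumes "fact_asymp \<alpha> \<beta> f c" "fact_asymp \<alpha> \<beta> g d"
  shows "fact_asymp \<alpha> \<beta> (f + g) (c + d)"
  unfolding fact_asymp_def
proof
  show "f + g - fps_cutoff R (c + d) * wt_base \<alpha> \<beta> \<in> wt_small \<alpha> \<beta> R" for R
    using wt_small_add[OF fact_asympD[OF assms(1)] fact_asympD[OF assms(2)], of R]
    by (simp add: algebra_simps fps_cutoff_add)
qed

lemma fact_asymp_finite:
  assumes "\<alpha> > 0" "\<beta> > 0" "fps_finite p"
  shows "fact_asymp \<alpha> \<beta> p 0"
  using assms by (simp add: fact_asymp_def wt_small_finite)

text \<open>Modulo the remainder space a product equals the truncation of \<open>f\<close> times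
  \<open>g\<close> plus the truncation of \<open>g\<close> times \<open>f\<close>. Inserting the
  truncated expansions of \<open>g\<close> and \<open>f\<close> gives the Leibniz rule.\<close>

lemma fact_asymp_mult:
  assumes pos: "\<alpha> > 0" "\<beta> > 0" and fc: "fact_asymp \<alpha> \<beta> f c" and gd: "fact_asymp \<alpha> \<beta> g d"
  shows "fact_asymp \<alpha> \<beta> (f * g) (f * d + c * g)"
proof (rule fact_asympI[OF pos])
  fix R
  let ?G = "wt_base \<alpha> \<beta>" and ?S = "wt_small \<alpha> \<beta> R"
  define f' g' c' d' where "f' = fps_cutoff R f" and "g' = fps_cutoff R g"
    and "c' = fps_cutoff R c" and "d' = fps_cutoff R d"
  have fin: "fps_finite f'" "fps_finite g'" "fps_finite c'" "fps_finite d'"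
    by (simp_all add: f'_def g'_def c'_def d'_def)
  have "fps_X ^ R dvd f' - f" "fps_X ^ R dvd g' - g" "fps_X ^ R dvd c' - c" "fps_X ^ R dvd d' - d"
    unfolding f'_def g'_def c'_def d'_def by (rule fps_X_power_dvd_cutoff_diff)+
  then have "fps_X ^ R dvd (f' - f) * d' + f * (d' - d) + ((c' - c) * g' + c * (g' - g))"
    by (intro dvd_add dvd_mult dvd_mult2) auto
  also have "\<dots> = (f' * d' + c' * g') - (f * d + c * g)" by (simp add: algebra_simps)
  finally have dvd: "fps_X ^ R dvd (f' * d' + c' * g') - (f * d + c * g)" .
  have "f * g - f' * g - f * g' \<in> ?S"
    unfolding f'_def g'_def by (intro wt_bounded_mult_expand pos) (use fc gd fact_asymp_bounded in auto)
  moreover have "f' * (g - d' * ?G) \<in> ?S" "g' * (f - c' * ?G) \<in> ?S"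
    using fact_asympD[OF gd, of R] fact_asympD[OF fc, of R] fin pos
    by (auto intro!: wt_small_finite_mult simp: c'_def d'_def)
  ultimately have "(f * g - f' * g - f * g') + (f' * (g - d' * ?G) + g' * (f - c' * ?G)) \<in> ?S"
    by (intro wt_small_add)
  then have "f * g - (f' * d' + c' * g') * ?G \<in> ?S" by (simp add: algebra_simps)
  with dvd fin show "\<exists>p. fps_finite p \<and> fps_X ^ R dvd p - (f * d + c * g) \<and> f * g - p * ?G \<in> ?S"
    by (intro exI[of _ "f' * d' + c' * g'"]) auto
qed

lemma fact_asymp_finite_mult:
  assumes "\<alpha> > 0" "\<beta> > 0" "fps_finite p" "fact_asymp \<alpha> \<beta> f c"
  shows "fact_asymp \<alpha> \<beta> (p * f) (p * c)"
  using fact_asymp_mult[OF assms(1,2) fact_asymp_finite[OF assms(1-3)] assms(4)] by simp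

lemma fact_asymp_uminus: "fact_asymp \<alpha> \<beta> f c \<Longrightarrow> fact_asymp \<alpha> \<beta> (- f) (- c)"
  using wt_small_uminus by (fastforce simp: fact_asymp_def fps_cutoff_uminus)

lemma fact_asymp_diff:
  assumes "fact_asymp \<alpha> \<beta> f c" "fact_asymp \<alpha> \<beta> g d"
  shows "fact_asymp \<alpha> \<beta> (f - g) (c - d)"
  using fact_asymp_add[OF assms(1) fact_asymp_uminus[OF assms(2)]] by simp

lemma fact_asymp_power:
  assumes "\<alpha> > 0" "\<beta> > 0" "fact_asymp \<alpha> \<beta> f c"
  shows "fact_asymp \<alpha> \<beta> (f ^ k) (of_nat k * f ^ (k - 1) * c)"
proof (induction k)
  case 0
  then show ?case using fact_asymp_finite[OF assms(1,2), of 1] fps_finite_const[of 1] by simp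
next
  case (Suc k)
  have "f * (of_nat k * f ^ (k - 1) * c) + c * f ^ k = of_nat (Suc k) * f ^ (Suc k - 1) * c"
    by (cases k) (simp_all add: algebra_simps)
  with fact_asymp_mult[OF assms Suc] show ?case by simp
qed

lemma fact_asymp_base:
  assumes "\<alpha> > 0" "\<beta> > 0"
  shows "fact_asymp \<alpha> \<beta> (wt_base \<alpha> \<beta>) 1"
proof (rule fact_asympI[OF assms])
  fix R
  show "\<exists>p. fps_finite p \<and> fps_X ^ R dvd p - 1 \<and> wt_base \<alpha> \<beta> - p * wt_base \<alpha> \<beta> \<in> wt_small \<alpha> \<beta> R"
    using wt_small_finite[OF assms fps_finite_const[of 0]] fps_finite_const[of 1]
    by (intro exI[of _ 1]) auto
qed

text \<open>This is the recurrence of the weights in differential form; the constant corrects the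
  coefficient at 0, which the recurrence does not reach.\<close>

lemma wt_base_ODE:
  assumes "\<alpha> > 0" "\<beta> > 0"
  shows "fps_const \<alpha> * fps_X ^ 2 * fps_deriv (wt_base \<alpha> \<beta>)
    = (1 - fps_const (\<alpha> * \<beta>) * fps_X) * wt_base \<alpha> \<beta> - fps_const (wt_base \<alpha> \<beta> $ 0)"
proof (rule fps_ext)
  fix n
  show "(fps_const \<alpha> * fps_X ^ 2 * fps_deriv (wt_base \<alpha> \<beta>)) $ n
    = ((1 - fps_const (\<alpha> * \<beta>) * fps_X) * wt_base \<alpha> \<beta> - fps_const (wt_base \<alpha> \<beta> $ 0)) $ n"
  proof (cases n)
    case (Suc m)
    have "(fps_const \<alpha> * fps_X ^ 2 * fps_deriv (wt_base \<alpha> \<beta>)) $ n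
        = \<alpha> * (real m * wt_base \<alpha> \<beta> $ m)"
      unfolding mult.assoc using Suc by (cases m) (simp_all add: fps_X_power_mult_nth)
    then show ?thesis using assms Suc
      by (simp add: left_diff_distrib mult.assoc wt_Suc) (simp add: algebra_simps)
  qed (simp add: mult.assoc fps_X_power_mult_nth left_diff_distrib)
qed

text \<open>On \<open>p * wt_base \<alpha> \<beta>\<close> the operator x^2 d/dx is computed from
  the product rule and the differential equation of G. The constant in that equation contributes
  only a polynomial, and the operator preserves the remainder space.\<close>

lemma fact_asymp_X2_deriv:
  assumes pos: "\<alpha> > 0" "\<beta> > 0" and fc: "fact_asymp \<alpha> \<beta> f c"
  shows "fact_asymp \<alpha> \<beta> (fps_X ^ 2 * fps_deriv f)
    (fps_const (1 / \<alpha>) * c - fps_const \<beta> * fps_X * c + fps_X ^ 2 * fps_deriv c)"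
proof (rule fact_asympI[OF pos])
  fix R
  let ?G = "wt_base \<alpha> \<beta>" and ?S = "wt_small \<alpha> \<beta> R"
  define p where "p = fps_cutoff R c"
  define u where "u = f - p * ?G"
  define q where "q = fps_const (1 / \<alpha>) * p - fps_const \<beta> * fps_X * p + fps_X ^ 2 * fps_deriv p"
  have p: "fps_finite p" "fps_X ^ R dvd p - c"
    unfolding p_def by (simp_all add: fps_X_power_dvd_cutoff_diff)
  have u: "u \<in> ?S" unfolding u_def p_def by (rule fact_asympD[OF fc])
  have "fps_X ^ R dvd fps_X ^ 2 * fps_deriv (p - c)"
  proof -
    have "(fps_X ^ 2 * fps_deriv (p - c)) $ i = 0" if "i < R" for i
      using that p(2) by (auto simp: fps_X_power_mult_nth fps_X_power_dvd_iff_nth)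
    then show ?thesis by (simp add: fps_X_power_dvd_iff_nth)
  qed
  then have "fps_X ^ R dvd fps_const (1 / \<alpha>) * (p - c) - fps_const \<beta> * fps_X * (p - c)
      + fps_X ^ 2 * fps_deriv (p - c)"
    by (intro dvd_add dvd_diff dvd_mult[OF p(2)])
  then have dvd: "fps_X ^ R dvd q - (fps_const (1 / \<alpha>) * c - fps_const \<beta> * fps_X * c + fps_X ^ 2 * fps_deriv c)"
    by (simp add: q_def algebra_simps)
  have fin: "fps_finite q" using p by (simp add: q_def)
  have ode: "fps_X ^ 2 * fps_deriv ?G = fps_const (1 / \<alpha>) * ?G - fps_const \<beta> * fps_X * ?G - fps_const (?G $ 0 / \<alpha>)"
  proof -
    have "fps_X ^ 2 * fps_deriv ?G = fps_const (1 / \<alpha>) * (fps_const \<alpha> * fps_X ^ 2 * fps_deriv ?G)"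
      using pos by (simp flip: mult.assoc)
    also have "\<dots> = fps_const (1 / \<alpha>) * ?G - (fps_const (1 / \<alpha>) * fps_const (\<alpha> * \<beta>)) * fps_X * ?G
        - fps_const (1 / \<alpha>) * fps_const (?G $ 0)"
      unfolding wt_base_ODE[OF pos] by (simp only: algebra_simps mult_1_left)
    finally show ?thesis using pos by simp
  qed
  have "f = p * ?G + u" by (simp add: u_def)
  then have "fps_X ^ 2 * fps_deriv f = fps_X ^ 2 * fps_deriv p * ?G + p * (fps_X ^ 2 * fps_deriv ?G)
      + fps_X ^ 2 * fps_deriv u"
    by (simp add: algebra_simps)
  also have "\<dots> = q * ?G + (fps_X ^ 2 * fps_deriv u - p * fps_const (?G $ 0 / \<alpha>))"
    unfolding ode q_def by (simp add: algebra_simps)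
  finally have "fps_X ^ 2 * fps_deriv f - q * ?G = fps_X ^ 2 * fps_deriv u - p * fps_const (?G $ 0 / \<alpha>)"
    by simp
  also have "\<dots> \<in> ?S"
    by (intro wt_small_diff wt_small_X2_deriv wt_small_finite pos u fps_finite_mult p fps_finite_const)
  finally show "\<exists>p. fps_finite p
      \<and> fps_X ^ R dvd p - (fps_const (1 / \<alpha>) * c - fps_const \<beta> * fps_X * c + fps_X ^ 2 * fps_deriv c)
      \<and> fps_X ^ 2 * fps_deriv f - p * ?G \<in> ?S"
    using fin dvd by blast
qed

text \<open>The model series for \<beta> + k is the one for \<beta> shifted by \<open>k\<close>.
  They differ by the factor x^k and a polynomial, so the same \<open>c\<close> serves on both
  sides.\<close>

lemma fact_asymp_X_power_mult_iff:
  assumes "\<alpha> > 0" "\<beta> > 0"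
  shows "fact_asymp \<alpha> \<beta> (fps_X ^ k * f) c \<longleftrightarrow> fact_asymp \<alpha> (\<beta> + real k) f c"
proof -
  let ?G = "wt_base \<alpha> \<beta>" and ?H = "wt_base \<alpha> (\<beta> + real k)"
  have "?H = fps_shift k ?G"
    using assms by (auto simp: fps_eq_iff wt_add powr_add powr_realpow)
  then have G: "?G = fps_X ^ k * ?H + fps_cutoff k ?G"
    by (simp add: fps_shift_cutoff')
  have "fps_X ^ k * f - fps_cutoff R c * ?G \<in> wt_small \<alpha> \<beta> R
      \<longleftrightarrow> f - fps_cutoff R c * ?H \<in> wt_small \<alpha> (\<beta> + real k) R" for R
  proof -
    define q where "q = fps_cutoff R c * fps_cutoff k ?G"
    have q: "q \<in> wt_small \<alpha> \<beta> R" unfolding q_def by (intro wt_small_finite assms) simp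
    have "fps_cutoff R c * ?G = fps_X ^ k * (fps_cutoff R c * ?H) + q"
      unfolding q_def by (subst G) (simp add: algebra_simps)
    then have eq: "fps_X ^ k * f - fps_cutoff R c * ?G = fps_X ^ k * (f - fps_cutoff R c * ?H) - q"
      by (simp add: algebra_simps)
    show ?thesis
      unfolding eq wt_small_X_power_mult_iff[OF assms, symmetric]
      using wt_small_diff[OF _ q] wt_small_add[OF _ q] by (metis diff_add_cancel)
  qed
  then show ?thesis by (simp add: fact_asymp_def)
qed

lemma fact_asymp_raise:
  assumes "\<alpha> > 0" "\<beta> > 0" "fact_asymp \<alpha> \<beta> f c"
  shows "fact_asymp \<alpha> (\<beta> + real k) f (fps_X ^ k * c)"
  using fact_asymp_finite_mult[OF assms(1,2) _ assms(3), of "fps_X ^ k"]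
    fact_asymp_X_power_mult_iff[OF assms(1,2)] by simp

text \<open>For n at least \<open>R\<close> the coefficients of the truncated multiple of G are
  exactly the partial sums of the expansion; the finitely many smaller n do not affect an
  O-estimate.\<close>

lemma has_fact_expansion_iff_fact_asymp:
  assumes "\<alpha> > 0" "\<beta> > 0"
  shows "has_fact_expansion \<alpha> \<beta> f (fps_nth c) \<longleftrightarrow> fact_asymp \<alpha> \<beta> f c"
proof -
  have "(\<lambda>n. f $ n - (\<Sum>k<R. c $ k * \<alpha> powr (real n + \<beta> - real k) * Gamma (real n + \<beta> - real k)))
          \<in> O(\<lambda>n. \<alpha> ^ n * Gamma (real n + \<beta> - real R))
      \<longleftrightarrow> f - fps_cutoff R c * wt_base \<alpha> \<beta> \<in> wt_small \<alpha> \<beta> R" (is "?l \<in> O(?r) \<longleftrightarrow> ?u \<in> _") for R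
  proof -
    have l: "?l n = ?u $ n" if "n \<ge> R" for n
    proof -
      have "(fps_cutoff R c * wt_base \<alpha> \<beta>) $ n = (\<Sum>k<R. c $ k * wt_base \<alpha> \<beta> $ (n - k))"
        unfolding fps_mult_nth by (rule sum.mono_neutral_cong_right) (use that in auto)
      also have "\<dots> = (\<Sum>k<R. c $ k * \<alpha> powr (real n + \<beta> - real k) * Gamma (real n + \<beta> - real k))"
      proof (rule sum.cong)
        fix k assume "k \<in> {..<R}"
        then have k: "k \<le> n" using that by simp
        have "\<alpha> powr (real n + \<beta> - real k) = \<alpha> powr (real (n - k) + \<beta>)"
          using k by (simp add: of_nat_diff algebra_simps)
        also have "\<dots> = \<alpha> ^ (n - k) * \<alpha> powr \<beta>" using assms by (simp only: powr_add powr_realpow)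
        finally show "c $ k * wt_base \<alpha> \<beta> $ (n - k)
            = c $ k * \<alpha> powr (real n + \<beta> - real k) * Gamma (real n + \<beta> - real k)"
          using k by (simp add: wt_def of_nat_diff algebra_simps)
      qed simp
      finally show ?thesis by simp
    qed
    have r: "norm (?r n) = \<alpha> ^ R * wt \<alpha> \<beta> (n - R)" if "n \<ge> R" for n
    proof -
      have "?r n = \<alpha> ^ R * wt \<alpha> \<beta> (n - R)"
        using that by (simp add: wt_def of_nat_diff algebra_simps flip: power_add)
      then show ?thesis using assms by simp
    qed
    show ?thesis
    proof
      assume "?l \<in> O(?r)"
      then obtain C where "\<forall>\<^sub>F n in at_top. norm (?l n) \<le> C * norm (?r n)"
        by (elim landau_o.bigE) auto
      then obtain N where N: "\<And>n. n \<ge> N \<Longrightarrow> norm (?l n) \<le> C * norm (?r n)"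
        by (auto simp: eventually_at_top_linorder)
      show "?u \<in> wt_small \<alpha> \<beta> R"
        unfolding wt_small_def mem_Collect_eq
      proof (rule wt_boundedI_eventually[OF assms])
        fix n assume "n \<ge> N"
        then show "\<bar>fps_shift R ?u $ n\<bar> \<le> C * \<alpha> ^ R * wt \<alpha> \<beta> n"
          using N[of "n + R"] l[of "n + R"] r[of "n + R"] by simp
      qed
    next
      assume "?u \<in> wt_small \<alpha> \<beta> R"
      then obtain C where C: "\<And>n. \<bar>fps_shift R ?u $ n\<bar> \<le> C * wt \<alpha> \<beta> n"
        by (auto simp: wt_small_def wt_bounded_def)
      show "?l \<in> O(?r)"
      proof (rule landau_o.bigI)
        show "\<forall>\<^sub>F n in at_top. norm (?l n) \<le> (\<bar>C\<bar> / \<alpha> ^ R + 1) * norm (?r n)"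
          using eventually_ge_at_top[of R]
        proof eventually_elim
          case (elim n)
          have "norm (?l n) \<le> C * wt \<alpha> \<beta> (n - R)"
            using C[of "n - R"] l[OF elim] elim by simp
          also have "\<dots> \<le> (\<bar>C\<bar> + \<alpha> ^ R) * wt \<alpha> \<beta> (n - R)"
            using assms by (intro mult_right_mono) (auto intro: add_increasing2)
          also have "\<dots> = (\<bar>C\<bar> / \<alpha> ^ R + 1) * norm (?r n)"
            unfolding r[OF elim] using assms by (simp add: field_simps)
          finally show ?case .
        qed
        show "\<bar>C\<bar> / \<alpha> ^ R + 1 > 0" using assms by (simp add: add_nonneg_pos)
      qed
    qed
  qed
  then show ?thesis by (simp add: has_fact_expansion_def fact_asymp_def)
qed

lemma fact_asymp_unique:
  assumes "\<alpha> > 0" "\<beta> > 0" "fact_asymp \<alpha> \<beta> f c" "fact_asymp \<alpha> \<beta> f d"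
  shows "c = d"
  using has_fact_expansion_unique[OF assms(1), of \<beta> f "fps_nth c" "fps_nth d"] assms
  by (simp add: has_fact_expansion_iff_fact_asymp fps_nth_inject)

lemma fact_div_fps_iff:
  assumes "\<alpha> > 0" "\<beta> > 0"
  shows "f \<in> fact_div_fps \<alpha> \<beta> \<longleftrightarrow> (\<exists>c. fact_asymp \<alpha> \<beta> f c)"
proof -
  have "fps_nth (Abs_fps c) = c" for c :: "nat \<Rightarrow> real" by (rule ext) simp
  then show ?thesis
    unfolding fact_div_fps_def mem_Collect_eq has_fact_expansion_iff_fact_asymp[OF assms, symmetric]
    by metis
qed

lemma asymp_deriv_eq:
  assumes "\<alpha> > 0" "\<beta> > 0" "fact_asymp \<alpha> \<beta> f c"
  shows "asymp_deriv \<alpha> \<beta> f = c"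
proof -
  have "(THE c. has_fact_expansion \<alpha> \<beta> f c) = fps_nth c"
    using assms has_fact_expansion_unique[OF assms(1)]
    by (intro the_equality) (auto simp: has_fact_expansion_iff_fact_asymp)
  then show ?thesis by (simp add: asymp_deriv_def fps_nth_inverse)
qed

section \<open>Substitution of a Moebius transformation\<close>

text \<open>As g^m starts at order m, the range of summation may be enlarged. A range common to all
  coefficients is what allows sums to be exchanged later.\<close>

lemma fps_compose_nth_le:
  fixes f g :: "real fps"
  assumes "g $ 0 = 0" "i \<le> n"
  shows "(f oo g) $ i = (\<Sum>m\<le>n. f $ m * (g ^ m) $ i)"
proof -
  have "(f oo g) $ i = (\<Sum>m\<le>i. f $ m * (g ^ m) $ i)"
    by (simp add: fps_compose_nth atLeast0AtMost)
  also have "\<dots> = (\<Sum>m\<le>n. f $ m * (g ^ m) $ i)"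
    using assms startsby_zero_power_prefix[OF assms(1)]
    by (intro sum.mono_neutral_left) auto
  finally show ?thesis .
qed

lemma fps_compose_mult_nth:
  fixes f g u :: "real fps"
  assumes "g $ 0 = 0"
  shows "((f oo g) * u) $ n = (\<Sum>m\<le>n. f $ m * (g ^ m * u) $ n)"
proof -
  have "((f oo g) * u) $ n = (\<Sum>i\<le>n. (\<Sum>m\<le>n. f $ m * (g ^ m) $ i) * u $ (n - i))"
    unfolding fps_mult_nth atLeast0AtMost
    by (intro sum.cong refl) (simp add: fps_compose_nth_le[OF assms, of _ n])
  also have "\<dots> = (\<Sum>i\<le>n. \<Sum>m\<le>n. f $ m * ((g ^ m) $ i * u $ (n - i)))"
    by (simp add: sum_distrib_right mult.assoc)
  also have "\<dots> = (\<Sum>m\<le>n. \<Sum>i\<le>n. f $ m * ((g ^ m) $ i * u $ (n - i)))"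
    by (rule sum.swap)
  also have "\<dots> = (\<Sum>m\<le>n. f $ m * (g ^ m * u) $ n)"
    by (simp add: fps_mult_nth atLeast0AtMost sum_distrib_left)
  finally show ?thesis .
qed

text \<open>The series of \<open>(1 - a x)\<^sup>-\<^sup>s\<close>.\<close>

definition neg_binomial :: "real \<Rightarrow> real \<Rightarrow> real fps" where
  "neg_binomial a s = Abs_fps (\<lambda>n. pochhammer s n / fact n * a ^ n)"

lemma neg_binomial_eq: "neg_binomial a s = fps_binomial (- s) oo (fps_const (- a) * fps_X)"
  unfolding fps_compose_linear neg_binomial_def
  by (simp add: gbinomial_pochhammer power_minus[of a] fps_eq_iff flip: mult.assoc power_add)

lemma neg_binomial_add: "neg_binomial a (s + t) = neg_binomial a s * neg_binomial a t"
  unfolding neg_binomial_eq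
  by (subst fps_compose_mult_distrib[symmetric]) (simp_all flip: fps_binomial_add_mult)

lemma neg_binomial_0 [simp]: "neg_binomial a 0 = 1"
  unfolding neg_binomial_eq by simp

lemma neg_binomial_power: "neg_binomial a s ^ m = neg_binomial a (real m * s)"
  by (induction m) (simp_all add: distrib_right neg_binomial_add)

lemma neg_binomial_nth_0 [simp]: "neg_binomial a s $ 0 = 1"
  by (simp add: neg_binomial_def)

text \<open>The series of x / (1 - a x).\<close>

definition moebius_fps :: "real \<Rightarrow> real fps" where
  "moebius_fps a = fps_X * neg_binomial a 1"

lemma moebius_nth_0 [simp]: "moebius_fps a $ 0 = 0"
  by (simp add: moebius_fps_def)

lemma moebius_nth_1 [simp]: "moebius_fps a $ Suc 0 = 1"
  by (simp add: moebius_fps_def)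

lemma moebius_nth_2: "moebius_fps a $ 2 = a"
  by (simp add: moebius_fps_def numeral_2_eq_2 neg_binomial_def)

lemma one_minus_mult_moebius: "(1 - fps_const a * fps_X) * moebius_fps a = fps_X"
proof (rule fps_ext)
  show "((1 - fps_const a * fps_X) * moebius_fps a) $ n = fps_X $ n" for n
    by (cases n; cases "n - 1")
      (auto simp: left_diff_distrib mult.assoc moebius_fps_def neg_binomial_def simp flip: pochhammer_fact)
qed

lemma moebius_compose_inverse: "moebius_fps a oo moebius_fps (- a) = fps_X"
proof -
  let ?m = "moebius_fps (- a)"
  have 1: "(1 - fps_const a * ?m) * (moebius_fps a oo ?m) = ?m"
    using arg_cong[OF one_minus_mult_moebius[of a], of "\<lambda>u. u oo ?m"]
    by (simp add: fps_compose_mult_distrib fps_compose_sub_distrib)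
  have 2: "(1 + fps_const a * fps_X) * ?m = fps_X"
    using one_minus_mult_moebius[of "- a"] by (simp flip: fps_const_neg)
  have "((1 + fps_const a * fps_X) - fps_const a * ((1 + fps_const a * fps_X) * ?m)) * (moebius_fps a oo ?m)
      = (1 + fps_const a * fps_X) * ?m"
    using arg_cong[OF 1, of "\<lambda>u. (1 + fps_const a * fps_X) * u"] by (simp add: algebra_simps)
  then show ?thesis unfolding 2 by simp
qed

text \<open>The m-th power of the Moebius series times (1 - a x)^(-\<beta>) is x^m (1 - a
  x)^(-m-\<beta>), whose coefficients are quotients of Gamma values and hence of weights. After
  division by the weights, the substitution becomes convolution with the coefficients of exp (a x /
  \<alpha>).\<close>

lemma compose_moebius_mult_nth:
  assumes "\<alpha> > 0" "\<beta> > 0"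
  shows "((f oo moebius_fps a) * neg_binomial a \<beta>) $ n
    = wt \<alpha> \<beta> n * (\<Sum>m\<le>n. f $ m / wt \<alpha> \<beta> m * ((a / \<alpha>) ^ (n - m) / fact (n - m)))"
proof -
  have "((f oo moebius_fps a) * neg_binomial a \<beta>) $ n
      = (\<Sum>m\<le>n. f $ m * (moebius_fps a ^ m * neg_binomial a \<beta>) $ n)"
    by (rule fps_compose_mult_nth) simp
  also have "\<dots> = (\<Sum>m\<le>n. wt \<alpha> \<beta> n * (f $ m / wt \<alpha> \<beta> m * ((a / \<alpha>) ^ (n - m) / fact (n - m))))"
  proof (rule sum.cong)
    fix m assume "m \<in> {..n}"
    then have m: "m \<le> n" by simp
    have "moebius_fps a ^ m * neg_binomial a \<beta> = fps_X ^ m * neg_binomial a (real m + \<beta>)"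
      by (simp add: moebius_fps_def power_mult_distrib neg_binomial_power neg_binomial_add mult.assoc)
    then have "(moebius_fps a ^ m * neg_binomial a \<beta>) $ n
        = pochhammer (real m + \<beta>) (n - m) / fact (n - m) * a ^ (n - m)"
      using m by (simp add: fps_X_power_mult_nth neg_binomial_def)
    also have "pochhammer (real m + \<beta>) (n - m) = Gamma (real n + \<beta>) / Gamma (real m + \<beta>)"
    proof -
      have "real m + \<beta> \<notin> \<int>\<^sub>\<le>\<^sub>0" using assms by (auto elim!: nonpos_Ints_cases)
      from pochhammer_Gamma[OF this] show ?thesis using m by (simp add: of_nat_diff add_ac)
    qed
    also have "Gamma (real n + \<beta>) / Gamma (real m + \<beta>) = wt \<alpha> \<beta> n / wt \<alpha> \<beta> m / \<alpha> ^ (n - m)"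
      using assms m by (simp add: wt_def power_diff)
    finally show "f $ m * (moebius_fps a ^ m * neg_binomial a \<beta>) $ n
        = wt \<alpha> \<beta> n * (f $ m / wt \<alpha> \<beta> m * ((a / \<alpha>) ^ (n - m) / fact (n - m)))"
      by (simp add: power_divide mult_ac)
  qed simp
  finally show ?thesis by (simp add: sum_distrib_left)
qed

text \<open>The weights outgrow every geometric sequence, so a series with positive radius of
  convergence has expansion 0.\<close>

lemma fact_asymp_geometric:
  assumes pos: "\<alpha> > 0" "\<beta> > 0" and \<rho>: "\<rho> > 0" and le: "\<And>n. \<bar>f $ n\<bar> \<le> C * \<rho> ^ n"
  shows "fact_asymp \<alpha> \<beta> f 0"
proof -
  obtain K where K: "K > 0" "\<And>n. \<rho> ^ n \<le> K * wt \<alpha> \<beta> n"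
    using power_le_wt[OF pos \<rho>] by blast
  have C: "C \<ge> 0" using le[of 0] by simp
  have "f \<in> wt_small \<alpha> \<beta> R" for R
    unfolding wt_small_def mem_Collect_eq
  proof (rule wt_boundedI)
    fix n
    have "\<bar>fps_shift R f $ n\<bar> \<le> C * \<rho> ^ R * \<rho> ^ n"
      using le[of "n + R"] by (simp add: power_add mult_ac)
    also have "\<dots> \<le> C * \<rho> ^ R * (K * wt \<alpha> \<beta> n)"
      using C \<rho> K by (intro mult_left_mono) auto
    finally show "\<bar>fps_shift R f $ n\<bar> \<le> (C * \<rho> ^ R * K) * wt \<alpha> \<beta> n" by (simp add: mult_ac)
  qed
  then show ?thesis by (simp add: fact_asymp_def)
qed

lemma neg_binomial_nth_le: "\<bar>neg_binomial a s $ n\<bar> \<le> ((\<bar>s\<bar> + 1) * (\<bar>a\<bar> + 1)) ^ n"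
proof -
  have *: "\<bar>pochhammer s n\<bar> \<le> (\<bar>s\<bar> + 1) ^ n * fact n"
  proof (induction n)
    case (Suc n)
    have "\<bar>pochhammer s (Suc n)\<bar> = \<bar>pochhammer s n\<bar> * \<bar>s + real n\<bar>"
      by (simp add: pochhammer_Suc abs_mult)
    also have "\<dots> \<le> ((\<bar>s\<bar> + 1) ^ n * fact n) * ((\<bar>s\<bar> + 1) * (1 + real n))"
    proof (rule mult_mono[OF Suc])
      have "\<bar>s\<bar> * real n \<ge> 0" by simp
      moreover have "\<bar>s + real n\<bar> \<le> \<bar>s\<bar> + real n" by simp
      moreover have "(\<bar>s\<bar> + 1) * (1 + real n) = \<bar>s\<bar> + real n + 1 + \<bar>s\<bar> * real n"
        by (simp add: algebra_simps)
      ultimately show "\<bar>s + real n\<bar> \<le> (\<bar>s\<bar> + 1) * (1 + real n)" by linarith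
    qed auto
    finally show ?case by (simp add: algebra_simps)
  qed simp
  have "\<bar>neg_binomial a s $ n\<bar> = \<bar>pochhammer s n\<bar> / fact n * \<bar>a\<bar> ^ n"
    by (simp add: neg_binomial_def abs_mult power_abs)
  also have "\<dots> \<le> (\<bar>s\<bar> + 1) ^ n * (\<bar>a\<bar> + 1) ^ n"
    using * by (intro mult_mono power_mono) (auto simp: divide_le_eq)
  finally show ?thesis by (simp add: power_mult_distrib)
qed

lemma fact_asymp_neg_binomial:
  assumes "\<alpha> > 0" "\<beta> > 0"
  shows "fact_asymp \<alpha> \<beta> (neg_binomial a s) 0"
  by (rule fact_asymp_geometric[OF assms, of "(\<bar>s\<bar> + 1) * (\<bar>a\<bar> + 1)" _ 1])
    (use neg_binomial_nth_le[of a s] in \<open>auto simp: add_nonneg_pos\<close>)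

lemma fact_asymp_moebius: "\<alpha> > 0 \<Longrightarrow> \<beta> > 0 \<Longrightarrow> fact_asymp \<alpha> \<beta> (moebius_fps a) 0"
  unfolding moebius_fps_def
  by (metis mult_zero_right fact_asymp_finite_mult fact_asymp_neg_binomial fps_finite_X)

lemma compose_moebius_eq:
  "f oo moebius_fps a = neg_binomial a (- \<beta>) * ((f oo moebius_fps a) * neg_binomial a \<beta>)"
proof -
  have "neg_binomial a (- \<beta>) * neg_binomial a \<beta> = 1"
    using neg_binomial_add[of a "- \<beta>" \<beta>] by simp
  then show ?thesis by (metis mult.left_commute mult.right_neutral)
qed

text \<open>Convolution with the absolutely summable coefficients of an exponential keeps the
  normalised coefficients bounded. The auxiliary power of 1 - a x is then removed inside the
  ring.\<close>

lemma wt_bounded_compose_moebius: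
  assumes pos: "\<alpha> > 0" "\<beta> > 0" and f: "f \<in> wt_bounded \<alpha> \<beta>"
  shows "f oo moebius_fps a \<in> wt_bounded \<alpha> \<beta>"
proof -
  obtain C where C: "C > 0" "\<And>n. \<bar>f $ n\<bar> \<le> C * wt \<alpha> \<beta> n" using wt_boundedE[OF f pos] by blast
  let ?t = "\<bar>a / \<alpha>\<bar>"
  have "(f oo moebius_fps a) * neg_binomial a \<beta> \<in> wt_bounded \<alpha> \<beta>"
  proof (rule wt_boundedI)
    fix n
    have "\<bar>\<Sum>m\<le>n. f $ m / wt \<alpha> \<beta> m * ((a / \<alpha>) ^ (n - m) / fact (n - m))\<bar>
        \<le> (\<Sum>m\<le>n. C * (?t ^ (n - m) / fact (n - m)))"
    proof (rule order_trans[OF sum_abs sum_mono])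
      fix m
      have "\<bar>f $ m\<bar> / wt \<alpha> \<beta> m \<le> C" using C(2)[of m] pos by (simp add: divide_le_eq)
      then have "\<bar>f $ m\<bar> / wt \<alpha> \<beta> m * (?t ^ (n - m) / fact (n - m)) \<le> C * (?t ^ (n - m) / fact (n - m))"
        by (rule mult_right_mono) simp
      then show "\<bar>f $ m / wt \<alpha> \<beta> m * ((a / \<alpha>) ^ (n - m) / fact (n - m))\<bar> \<le> C * (?t ^ (n - m) / fact (n - m))"
        using pos by (simp add: abs_mult power_abs)
    qed
    also have "\<dots> = C * (\<Sum>m\<le>n. ?t ^ m / fact m)"
      unfolding sum_distrib_left
      by (rule sum.reindex_bij_witness[of _ "\<lambda>m. n - m" "\<lambda>m. n - m"]) auto
    also have "\<dots> \<le> C * exp ?t"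
    proof (rule mult_left_mono)
      have "(\<lambda>m. ?t ^ m / fact m) sums exp ?t"
        using exp_converges[of ?t] by (simp add: field_simps)
      then show "(\<Sum>m\<le>n. ?t ^ m / fact m) \<le> exp ?t"
        using sum_le_suminf[of "\<lambda>m. ?t ^ m / fact m" "{..n}"] by (auto simp: sums_iff)
    qed (use C in simp)
    finally have "wt \<alpha> \<beta> n * \<bar>\<Sum>m\<le>n. f $ m / wt \<alpha> \<beta> m * ((a / \<alpha>) ^ (n - m) / fact (n - m))\<bar>
        \<le> wt \<alpha> \<beta> n * (C * exp ?t)"
      using pos by (intro mult_left_mono) auto
    then show "\<bar>((f oo moebius_fps a) * neg_binomial a \<beta>) $ n\<bar> \<le> (C * exp ?t) * wt \<alpha> \<beta> n"
      unfolding compose_moebius_mult_nth[OF pos] using pos by (simp add: abs_mult mult_ac)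
  qed
  from wt_bounded_mult[OF pos fact_asymp_bounded[OF fact_asymp_neg_binomial[OF pos, of a "- \<beta>"]] this]
  show ?thesis unfolding compose_moebius_eq[symmetric] .
qed

lemma wt_le_fact:
  assumes "\<alpha> > 0" "\<beta> > 0"
  shows "wt \<alpha> \<beta> n \<le> wt \<alpha> \<beta> 0 * (\<alpha> * (1 + \<beta>)) ^ n * fact n"
proof (induction n)
  case (Suc n)
  have "wt \<alpha> \<beta> (Suc n) = \<alpha> * (real n + \<beta>) * wt \<alpha> \<beta> n" using assms by (simp add: wt_Suc)
  also have "\<dots> \<le> (\<alpha> * ((1 + \<beta>) * (1 + real n))) * (wt \<alpha> \<beta> 0 * (\<alpha> * (1 + \<beta>)) ^ n * fact n)"
    using assms by (intro mult_mono[OF _ Suc]) (auto simp: algebra_simps)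
  finally show ?case by (simp add: algebra_simps)
qed simp

text \<open>For G the normalised coefficients are constant, so the convolution produces partial sums
  of exp (a / \<alpha>). Replacing them by the full exponential changes the series by one of
  geometric growth, which has expansion 0.\<close>

lemma fact_asymp_base_compose_moebius:
  assumes pos: "\<alpha> > 0" "\<beta> > 0"
  shows "fact_asymp \<alpha> \<beta> (wt_base \<alpha> \<beta> oo moebius_fps a) (fps_const (exp (a / \<alpha>)) * neg_binomial a (- \<beta>))"
proof -
  let ?G = "wt_base \<alpha> \<beta>" and ?t = "a / \<alpha>"
  define Z where "Z = (?G oo moebius_fps a) * neg_binomial a \<beta>"
  define E where "E = Z - fps_const (exp ?t) * ?G"
  define \<rho> where "\<rho> = \<alpha> * (1 + \<beta>) * (\<bar>?t\<bar> + 1)"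
  have Z: "Z $ n = ?G $ n * (\<Sum>m\<le>n. ?t ^ m / fact m)" for n
  proof -
    have "Z $ n = wt \<alpha> \<beta> n * (\<Sum>m\<le>n. \<alpha> powr \<beta> * (?t ^ (n - m) / fact (n - m)))"
      unfolding Z_def compose_moebius_mult_nth[OF pos] using wt_pos[OF pos]
      by (intro arg_cong2[of _ _ _ _ "(*)"] sum.cong refl) (simp add: less_imp_neq[THEN not_sym])
    also have "(\<Sum>m\<le>n. \<alpha> powr \<beta> * (?t ^ (n - m) / fact (n - m))) = \<alpha> powr \<beta> * (\<Sum>m\<le>n. ?t ^ m / fact m)"
      unfolding sum_distrib_left
      by (rule sum.reindex_bij_witness[of _ "\<lambda>m. n - m" "\<lambda>m. n - m"]) auto
    finally show ?thesis by simp
  qed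
  have E_le: "\<bar>E $ n\<bar> \<le> (\<alpha> powr \<beta> * wt \<alpha> \<beta> 0 * exp \<bar>?t\<bar> * (\<bar>?t\<bar> + 1)) * \<rho> ^ n" for n
  proof -
    \<comment> \<open>The defect of the partial sum is a Lagrange remainder; its factorial
      denominator cancels the factorial growth of the weights.\<close>
    obtain \<theta> where \<theta>: "\<bar>\<theta>\<bar> \<le> \<bar>?t\<bar>"
      "exp ?t = (\<Sum>m<Suc n. ?t ^ m / fact m) + exp \<theta> / fact (Suc n) * ?t ^ Suc n"
      using Maclaurin_exp_le[of ?t "Suc n"] by blast
    have "E $ n = - (?G $ n * (exp \<theta> / fact (Suc n) * ?t ^ Suc n))"
      by (simp add: E_def Z \<theta>(2) lessThan_Suc_atMost algebra_simps)
    then have "\<bar>E $ n\<bar> = ?G $ n * (exp \<theta> / fact (Suc n) * \<bar>?t\<bar> ^ Suc n)"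
      using pos by (simp add: abs_mult power_abs del: power_Suc fact_Suc)
    also have "\<dots> \<le> ?G $ n * (exp \<bar>?t\<bar> / fact n * (\<bar>?t\<bar> + 1) ^ Suc n)"
      using pos \<theta>(1)
      by (intro mult_left_mono mult_mono frac_le power_mono fact_mono) (auto simp del: fact_Suc)
    also have "\<dots> \<le> (\<alpha> powr \<beta> * (wt \<alpha> \<beta> 0 * (\<alpha> * (1 + \<beta>)) ^ n * fact n))
        * (exp \<bar>?t\<bar> / fact n * (\<bar>?t\<bar> + 1) ^ Suc n)"
      using wt_le_fact[OF pos, of n] pos by (intro mult_right_mono) auto
    finally show ?thesis by (simp add: \<rho>_def power_mult_distrib mult_ac)
  qed
  have "fact_asymp \<alpha> \<beta> E 0"
    using pos by (intro fact_asymp_geometric[OF pos _ E_le]) (simp add: \<rho>_def add_nonneg_pos)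
  from fact_asymp_add[OF this fact_asymp_finite_mult[OF pos _ fact_asymp_base[OF pos], of "fps_const (exp ?t)"]]
  have "fact_asymp \<alpha> \<beta> Z (fps_const (exp ?t))" by (simp add: E_def)
  from fact_asymp_mult[OF pos fact_asymp_neg_binomial[OF pos] this, of a "- \<beta>"]
  show ?thesis
    unfolding Z_def compose_moebius_eq[symmetric] by (simp add: mult.commute)
qed

section \<open>Substitution of a series tangent to the identity to second order\<close>

text \<open>Write \<delta> = x^3 u. By the convolution bound with offset 3, each further factor
  \<open>u\<close> costs only a constant. The offset in the bound thus stays 3 while the order of
  \<delta>^j grows to 3 j.\<close>

lemma wt_bounded_X3_power_bound:
  assumes pos: "\<alpha> > 0" "\<beta> > 0" and \<delta>: "\<delta> \<in> wt_bounded \<alpha> \<beta>" "fps_X ^ 3 dvd \<delta>"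
  obtains K where "K > 0" "\<And>j i. j \<ge> 1 \<Longrightarrow> i < 3 * j \<Longrightarrow> (\<delta> ^ j) $ i = 0"
    "\<And>j i. j \<ge> 1 \<Longrightarrow> i \<ge> 3 * j \<Longrightarrow> \<bar>(\<delta> ^ j) $ i\<bar> \<le> K ^ j * wt \<alpha> \<beta> (i - 3 * j + 3)"
proof -
  let ?w = "wt \<alpha> \<beta>"
  obtain u where u: "\<delta> = fps_X ^ 3 * u" using \<delta> by blast
  obtain C where C: "C > 0" "\<And>n. \<bar>\<delta> $ n\<bar> \<le> C * ?w n" using wt_boundedE[OF \<delta>(1) pos] by blast
  obtain D where D: "D \<ge> 0" "\<And>n. (\<Sum>i\<le>n. ?w (i + 3) * ?w (n - i + 3)) \<le> D * ?w (n + 3)"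
    using wt_convolution[OF pos, of 3] by blast
  \<comment> \<open>\<open>K\<close> dominates both \<open>C\<close>, for the first power, and
    \<open>C * D\<close>, for each inductive step.\<close>
  define K where "K = C * (1 + D)"
  have K: "K > 0" "C \<le> K" "C * D \<le> K" using C D by (auto simp: K_def distrib_left intro: add_pos_nonneg)
  have u1: "\<bar>u $ n\<bar> \<le> C * ?w (n + 3)" for n
    using C(2)[of "n + 3"] by (simp add: u fps_X_power_mult_nth)
  have uj: "\<bar>(u ^ Suc j) $ n\<bar> \<le> K ^ Suc j * ?w (n + 3)" for j n
  proof (induction j arbitrary: n)
    case 0
    have "C * ?w (n + 3) \<le> K * ?w (n + 3)" using K pos by (intro mult_right_mono) auto
    then show ?case using u1[of n] by simp
  next
    case (Suc j)
    have "\<bar>(u ^ Suc (Suc j)) $ n\<bar> \<le> (\<Sum>i\<le>n. \<bar>u $ i\<bar> * \<bar>(u ^ Suc j) $ (n - i)\<bar>)"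
      unfolding power_Suc[of u "Suc j"] fps_mult_nth atLeast0AtMost
      by (rule order_trans[OF sum_abs]) (simp add: abs_mult)
    also have "\<dots> \<le> (\<Sum>i\<le>n. (C * ?w (i + 3)) * (K ^ Suc j * ?w (n - i + 3)))"
      using C K pos by (intro sum_mono mult_mono u1 Suc.IH) auto
    also have "\<dots> = K ^ Suc j * C * (\<Sum>i\<le>n. ?w (i + 3) * ?w (n - i + 3))"
      by (simp add: sum_distrib_left mult_ac)
    also have "\<dots> \<le> K ^ Suc j * C * (D * ?w (n + 3))"
      using C K D by (intro mult_left_mono) auto
    also have "\<dots> = (K ^ Suc j * ?w (n + 3)) * (C * D)" by (simp add: mult_ac)
    also have "\<dots> \<le> (K ^ Suc j * ?w (n + 3)) * K"
      using K pos by (intro mult_left_mono) auto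
    finally show ?case by (simp add: mult_ac)
  qed
  have \<delta>j: "\<delta> ^ j = fps_X ^ (3 * j) * u ^ j" for j
    by (simp add: u power_mult_distrib power_mult)
  show ?thesis
  proof
    show "K > 0" by (rule K)
    show "(\<delta> ^ j) $ i = 0" if "j \<ge> 1" "i < 3 * j" for i j
      using that by (simp add: \<delta>j fps_X_power_mult_nth)
    show "\<bar>(\<delta> ^ j) $ i\<bar> \<le> K ^ j * ?w (i - 3 * j + 3)" if "j \<ge> 1" "i \<ge> 3 * j" for i j
      using that uj[of "j - 1" "i - 3 * j"] by (simp add: \<delta>j fps_X_power_mult_nth del: power_Suc)
  qed
qed

text \<open>The binomial coefficient is at most m^j / j!, and each step up in the weights gains a
  factor of at least \<alpha> m.\<close>

lemma binomial_mult_wt_le: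
  assumes pos: "\<alpha> > 0" "\<beta> > 0"
  shows "real (m choose j) * wt \<alpha> \<beta> m \<le> wt \<alpha> \<beta> (m + j) / (\<alpha> ^ j * fact j)"
proof -
  have "(\<alpha> * real m) ^ j * wt \<alpha> \<beta> m \<le> wt \<alpha> \<beta> (m + j)"
  proof (induction j)
    case (Suc j)
    have "(\<alpha> * real m) ^ Suc j * wt \<alpha> \<beta> m = (\<alpha> * real m) * ((\<alpha> * real m) ^ j * wt \<alpha> \<beta> m)"
      by (simp add: mult_ac)
    also have "\<dots> \<le> (\<alpha> * (real (m + j) + \<beta>)) * wt \<alpha> \<beta> (m + j)"
      using pos by (intro mult_mono[OF _ Suc]) auto
    finally show ?case using pos by (simp add: wt_Suc)
  qed simp
  moreover have "real (m choose j) * fact j \<le> real m ^ j"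
    using binomial_fact_pow[of m j] by (metis of_nat_fact of_nat_le_iff of_nat_mult of_nat_power)
  then have "(\<alpha> ^ j * wt \<alpha> \<beta> m) * (real (m choose j) * fact j) \<le> (\<alpha> ^ j * wt \<alpha> \<beta> m) * real m ^ j"
    using pos by (intro mult_left_mono) auto
  ultimately have "real (m choose j) * wt \<alpha> \<beta> m * (\<alpha> ^ j * fact j) \<le> wt \<alpha> \<beta> (m + j)"
    by (simp add: power_mult_distrib mult_ac)
  then show ?thesis using pos by (simp add: le_divide_eq)
qed

text \<open>Since \<open>\<delta> = O(x\<^sup>3)\<close>, a Taylor term of order \<open>j\<close> gains \<open>2j\<close> powers of \<open>n\<close> from the derivative but loses
  \<open>3j\<close> from \<open>\<delta>\<^sup>j\<close>.\<close>

lemma taylor_tail_bound: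
  assumes pos: "\<alpha> > 0" "\<beta> > 0" and \<delta>: "\<delta> \<in> wt_bounded \<alpha> \<beta>" "fps_X ^ 3 dvd \<delta>"
  obtains C where "C > 0" "\<And>J n. 1 \<le> J \<Longrightarrow> J \<le> n \<Longrightarrow>
    (\<Sum>m=2..n. \<Sum>j=J..m. wt \<alpha> \<beta> m * (real (m choose j) * \<bar>(\<delta> ^ j) $ (n + j - m)\<bar>)) \<le> C * wt \<alpha> \<beta> (n - J)"
proof -
  let ?w = "wt \<alpha> \<beta>"
  obtain K where K: "K > 0" "\<And>j i. j \<ge> 1 \<Longrightarrow> i < 3 * j \<Longrightarrow> (\<delta> ^ j) $ i = 0"
    "\<And>j i. j \<ge> 1 \<Longrightarrow> i \<ge> 3 * j \<Longrightarrow> \<bar>(\<delta> ^ j) $ i\<bar> \<le> K ^ j * ?w (i - 3 * j + 3)"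
    using wt_bounded_X3_power_bound[OF pos \<delta>] by blast
  obtain D where D: "D \<ge> 0" "\<And>n. (\<Sum>i\<le>n. ?w (i + 3) * ?w (n - i + 3)) \<le> D * ?w (n + 3)"
    using wt_convolution[OF pos, of 3] by blast
  obtain L where L: "L > 0" "\<And>i n. i \<le> n \<Longrightarrow> ?w i \<le> L * ?w n"
    using wt_quasi_mono[OF pos] by blast
  define c where "c = K / \<alpha>"
  have c: "c > 0" using K pos by (simp add: c_def)
  \<comment> \<open>The majorant is zero where \<delta>^j has no coefficient, that is, where n + j -
    m < 3 j.\<close>
  define b where "b = (\<lambda>n m j. if m + 2 * j \<le> n then ?w (m + j) * ?w (n - m - 2 * j + 3) else 0)"
  have b0: "b n m j \<ge> 0" for n m j using pos by (simp add: b_def)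
  have term_le: "?w m * (real (m choose j) * \<bar>(\<delta> ^ j) $ (n + j - m)\<bar>) \<le> c ^ j / fact j * b n m j"
    if "m \<le> n" "j \<ge> 1" for m n j
  proof (cases "m + 2 * j \<le> n")
    case True
    then have "n + j - m \<ge> 3 * j" "n + j - m - 3 * j + 3 = n - m - 2 * j + 3" by auto
    then have "\<bar>(\<delta> ^ j) $ (n + j - m)\<bar> \<le> K ^ j * ?w (n - m - 2 * j + 3)"
      using K(3)[of j "n + j - m"] that by simp
    then have "(real (m choose j) * ?w m) * \<bar>(\<delta> ^ j) $ (n + j - m)\<bar>
        \<le> (?w (m + j) / (\<alpha> ^ j * fact j)) * (K ^ j * ?w (n - m - 2 * j + 3))"
      using pos by (intro mult_mono binomial_mult_wt_le) auto
    then show ?thesis using True by (simp add: b_def c_def power_divide mult_ac)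
  next
    case False
    then have "n + j - m < 3 * j" using that by auto
    then show ?thesis using K(2)[of j "n + j - m"] that False by (simp add: b_def)
  qed
  \<comment> \<open>For j at least 1 and m at least 2 one has m + j at least 3, so m + j = i + 3 for
    a natural number i. The sum then becomes part of a convolution with offset 3 and total n - j -
    3.\<close>
  have b_sum: "(\<Sum>m=2..n. b n m j) \<le> D * ?w (n - j)" if "j \<ge> 1" "j \<le> n" for n j
  proof (cases "2 + 2 * j \<le> n")
    case True
    define N where "N = n - j - 3"
    have N: "N + 3 = n - j" using True that by (simp add: N_def)
    let ?g = "\<lambda>i. ?w (i + 3) * ?w (N - i + 3)"
    have "(\<Sum>m=2..n. b n m j) = (\<Sum>m=2..n-2*j. ?g (m + j - 3))"
    proof (rule sum.mono_neutral_cong_right)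
      fix m assume "m \<in> {2..n - 2 * j}"
      then have "m + j - 3 + 3 = m + j" "N - (m + j - 3) + 3 = n - m - 2 * j + 3" "m + 2 * j \<le> n"
        using that True by (auto simp: N_def)
      then show "b n m j = ?g (m + j - 3)" by (simp add: b_def)
    qed (auto simp: b_def)
    also have "\<dots> = sum ?g ((\<lambda>m. m + j - 3) ` {2..n-2*j})"
      using that by (subst sum.reindex) (auto simp: inj_on_def)
    also have "\<dots> \<le> sum ?g {..N}"
      using that True pos by (intro sum_mono2) (auto simp: N_def)
    also have "\<dots> \<le> D * ?w (n - j)" using D(2)[of N] N by simp
    finally show ?thesis .
  next
    case False
    then have "(\<Sum>m=2..n. b n m j) = 0" by (intro sum.neutral) (auto simp: b_def)
    then show ?thesis using D pos by simp
  qed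
  show ?thesis
  proof
    show "(D + 1) * L * exp c > 0" using D L by simp
    fix J n :: nat assume J: "1 \<le> J" "J \<le> n"
    have "(\<Sum>m=2..n. \<Sum>j=J..m. ?w m * (real (m choose j) * \<bar>(\<delta> ^ j) $ (n + j - m)\<bar>))
        \<le> (\<Sum>m=2..n. \<Sum>j=J..m. c ^ j / fact j * b n m j)"
      using J by (intro sum_mono term_le) auto
    \<comment> \<open>The range of j is made independent of m so that the sums can be exchanged; the
      remaining sum over j is a partial sum of exp c.\<close>
    also have "\<dots> \<le> (\<Sum>m=2..n. \<Sum>j=J..n. c ^ j / fact j * b n m j)"
      using c b0 by (intro sum_mono sum_mono2) auto
    also have "\<dots> = (\<Sum>j=J..n. c ^ j / fact j * (\<Sum>m=2..n. b n m j))"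
      by (subst sum.swap) (simp add: sum_distrib_left)
    also have "\<dots> \<le> (\<Sum>j=J..n. c ^ j / fact j * ((D + 1) * (L * ?w (n - J))))"
    proof (intro sum_mono mult_left_mono)
      fix j assume j: "j \<in> {J..n}"
      have "(\<Sum>m=2..n. b n m j) \<le> D * ?w (n - j)" using b_sum[of j n] j J by simp
      also have "\<dots> \<le> (D + 1) * (L * ?w (n - J))"
        using D L(2)[of "n - j" "n - J"] j pos by (intro mult_mono) auto
      finally show "(\<Sum>m=2..n. b n m j) \<le> (D + 1) * (L * ?w (n - J))" .
    qed (use c in auto)
    also have "\<dots> = (\<Sum>j=J..n. c ^ j / fact j) * ((D + 1) * (L * ?w (n - J)))"
      by (simp add: sum_distrib_right)
    also have "\<dots> \<le> exp c * ((D + 1) * (L * ?w (n - J)))"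
    proof (rule mult_right_mono)
      have "(\<lambda>j. c ^ j / fact j) sums exp c"
        using exp_converges[of c] by (simp add: field_simps)
      then show "(\<Sum>j=J..n. c ^ j / fact j) \<le> exp c"
        using sum_le_suminf[of "\<lambda>j. c ^ j / fact j" "{J..n}"] c by (auto simp: sums_iff)
    qed (use D L pos in auto)
    finally show "(\<Sum>m=2..n. \<Sum>j=J..m. ?w m * (real (m choose j) * \<bar>(\<delta> ^ j) $ (n + j - m)\<bar>))
        \<le> (D + 1) * L * exp c * ?w (n - J)" by (simp add: mult_ac)
  qed
qed

section \<open>Taylor expansion of f(x + \<delta>) in powers of \<delta>\<close>

definition taylor_coeff :: "nat \<Rightarrow> real fps \<Rightarrow> real fps" where
  "taylor_coeff j f = Abs_fps (\<lambda>i. real ((i + j) choose j) * f $ (i + j))"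

lemma taylor_coeff_0 [simp]: "taylor_coeff 0 f = f"
  by (simp add: taylor_coeff_def fps_eq_iff)

lemma taylor_coeff_Suc:
  "taylor_coeff (Suc j) f = fps_const (1 / real (Suc j)) * fps_deriv (taylor_coeff j f)"
proof (rule fps_ext)
  fix i
  have "Suc j * (Suc (i + j) choose Suc j) = Suc (i + j) * (i + j choose j)"
    by (rule Suc_times_binomial)
  moreover have "Suc i * (Suc (i + j) choose j) = Suc (i + j) * (i + j choose j)"
    using binomial_absorb_comp[of "Suc (i + j)" j] by simp
  ultimately have "Suc j * (Suc (i + j) choose Suc j) = Suc i * (Suc (i + j) choose j)" by simp
  then have "real (Suc j) * real (Suc (i + j) choose Suc j) = real (Suc i) * real (Suc (i + j) choose j)"
    by (metis of_nat_mult)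
  then have "real (Suc (i + j) choose Suc j) = real (Suc i) * real (Suc (i + j) choose j) / real (Suc j)"
    by (simp add: eq_divide_eq mult.commute)
  then show "taylor_coeff (Suc j) f $ i = (fps_const (1 / real (Suc j)) * fps_deriv (taylor_coeff j f)) $ i"
    by (simp add: taylor_coeff_def del: of_nat_Suc)
qed

lemma taylor_coeff_mult_nth:
  fixes \<delta> :: "real fps"
  assumes "\<delta> $ 0 = 0"
  shows "(taylor_coeff j f * \<delta> ^ j) $ n = (\<Sum>m\<le>n. f $ m * (real (m choose j) * (\<delta> ^ j) $ (n + j - m)))"
proof -
  have z: "(\<delta> ^ j) $ i = 0" if "i < j" for i
    using startsby_zero_power_prefix[OF assms] that by blast
  have "(taylor_coeff j f * \<delta> ^ j) $ n
      = (\<Sum>i\<in>{i. i + j \<le> n}. f $ (i + j) * (real ((i + j) choose j) * (\<delta> ^ j) $ (n - i)))"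
    unfolding fps_mult_nth
    by (rule sum.mono_neutral_cong_right) (auto simp: taylor_coeff_def z)
  also have "\<dots> = (\<Sum>m\<in>{j..n}. f $ m * (real (m choose j) * (\<delta> ^ j) $ (n + j - m)))"
    by (rule sum.reindex_bij_witness[of _ "\<lambda>m. m - j" "\<lambda>i. i + j"]) auto
  also have "\<dots> = (\<Sum>m\<le>n. f $ m * (real (m choose j) * (\<delta> ^ j) $ (n + j - m)))"
    by (rule sum.mono_neutral_left) auto
  finally show ?thesis .
qed

lemma X_plus_power_nth:
  fixes \<delta> :: "real fps"
  assumes "m \<le> n"
  shows "((fps_X + \<delta>) ^ m) $ n = (\<Sum>j\<le>m. real (m choose j) * (\<delta> ^ j) $ (n + j - m))"
proof -
  have "((fps_X + \<delta>) ^ m) $ n = (\<Sum>j\<le>m. (of_nat (m choose j) * \<delta> ^ j * fps_X ^ (m - j)) $ n)"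
    by (simp add: add.commute[of fps_X] binomial_ring fps_sum_nth)
  also have "\<dots> = (\<Sum>j\<le>m. real (m choose j) * (\<delta> ^ j) $ (n + j - m))"
  proof (rule sum.cong)
    fix j assume "j \<in> {..m}"
    then have "n - (m - j) = n + j - m" "\<not> n < m - j" using assms by auto
    then show "(of_nat (m choose j) * \<delta> ^ j * fps_X ^ (m - j)) $ n = real (m choose j) * (\<delta> ^ j) $ (n + j - m)"
      by (simp add: fps_X_power_mult_right_nth flip: fps_of_nat)
  qed simp
  finally show ?thesis .
qed

text \<open>Each power of x + \<delta> is expanded by the binomial theorem and the terms with j < J
  are subtracted. The vanishing of the first two coefficients of \<open>f\<close> lets m start at 2,
  the range covered by the tail bound.\<close>

lemma taylor_remainder_nth:
  fixes \<delta> :: "real fps"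
  assumes \<delta>: "\<delta> $ 0 = 0" and f: "f $ 0 = 0" "f $ Suc 0 = 0"
  shows "((f oo (fps_X + \<delta>)) - (\<Sum>j<J. taylor_coeff j f * \<delta> ^ j)) $ n
    = (\<Sum>m=2..n. \<Sum>j=J..m. f $ m * (real (m choose j) * (\<delta> ^ j) $ (n + j - m)))"
proof -
  let ?T = "\<lambda>m j. real (m choose j) * (\<delta> ^ j) $ (n + j - m)"
  have split: "(\<Sum>j\<le>m. ?T m j) - (\<Sum>j<J. ?T m j) = (\<Sum>j=J..m. ?T m j)" for m
  proof -
    have "(\<Sum>j\<le>m. ?T m j) = (\<Sum>j<Suc m + J. ?T m j)"
      by (rule sum.mono_neutral_left) auto
    also have "{..<Suc m + J} = {..<J} \<union> {J..<Suc m + J}" by auto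
    also have "(\<Sum>j\<in>\<dots>. ?T m j) = (\<Sum>j<J. ?T m j) + (\<Sum>j=J..<Suc m + J. ?T m j)"
      by (rule sum.union_disjoint) auto
    also have "(\<Sum>j=J..<Suc m + J. ?T m j) = (\<Sum>j=J..m. ?T m j)"
      by (rule sum.mono_neutral_right) auto
    finally show ?thesis by simp
  qed
  have "(f oo (fps_X + \<delta>)) $ n = (\<Sum>m\<le>n. f $ m * (\<Sum>j\<le>m. ?T m j))"
    unfolding fps_compose_nth atLeast0AtMost by (intro sum.cong) (auto simp: X_plus_power_nth)
  moreover have "(\<Sum>j<J. taylor_coeff j f * \<delta> ^ j) $ n = (\<Sum>m\<le>n. f $ m * (\<Sum>j<J. ?T m j))"
    unfolding fps_sum_nth taylor_coeff_mult_nth[OF \<delta>] by (subst sum.swap) (simp add: sum_distrib_left)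
  ultimately have "((f oo (fps_X + \<delta>)) - (\<Sum>j<J. taylor_coeff j f * \<delta> ^ j)) $ n
      = (\<Sum>m\<le>n. f $ m * ((\<Sum>j\<le>m. ?T m j) - (\<Sum>j<J. ?T m j)))"
    by (simp only: fps_sub_nth right_diff_distrib sum_subtractf)
  also have "\<dots> = (\<Sum>m\<le>n. f $ m * (\<Sum>j=J..m. ?T m j))" by (simp only: split)
  also have "\<dots> = (\<Sum>m=2..n. f $ m * (\<Sum>j=J..m. ?T m j))"
  proof (rule sum.mono_neutral_right)
    show "\<forall>m\<in>{..n} - {2..n}. f $ m * (\<Sum>j=J..m. ?T m j) = 0"
    proof
      fix m assume "m \<in> {..n} - {2..n}"
      then have "m = 0 \<or> m = Suc 0" by auto
      then show "f $ m * (\<Sum>j=J..m. ?T m j) = 0" using f by auto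
    qed
  qed auto
  finally show ?thesis by (simp add: sum_distrib_left)
qed

lemma taylor_remainder_small:
  assumes pos: "\<alpha> > 0" "\<beta> > 0" and \<delta>: "\<delta> \<in> wt_bounded \<alpha> \<beta>" "fps_X ^ 3 dvd \<delta>"
    and f: "f \<in> wt_bounded \<alpha> \<beta>" "f $ 0 = 0" "f $ Suc 0 = 0" and J: "J \<ge> 1"
  shows "(f oo (fps_X + \<delta>)) - (\<Sum>j<J. taylor_coeff j f * \<delta> ^ j) \<in> wt_small \<alpha> \<beta> J"
proof -
  let ?w = "wt \<alpha> \<beta>"
  obtain C where C: "C > 0" "\<And>J n. 1 \<le> J \<Longrightarrow> J \<le> n \<Longrightarrow>
      (\<Sum>m=2..n. \<Sum>j=J..m. ?w m * (real (m choose j) * \<bar>(\<delta> ^ j) $ (n + j - m)\<bar>)) \<le> C * ?w (n - J)"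
    using taylor_tail_bound[OF pos \<delta>] by blast
  obtain F where F: "F > 0" "\<And>n. \<bar>f $ n\<bar> \<le> F * ?w n" using wt_boundedE[OF f(1) pos] by blast
  have \<delta>0: "\<delta> $ 0 = 0" using \<delta>(2) by (simp add: fps_X_power_dvd_iff_nth)
  show ?thesis unfolding wt_small_def mem_Collect_eq
  proof (rule wt_boundedI)
    fix n
    let ?T = "\<lambda>m j. real (m choose j) * (\<delta> ^ j) $ (n + J + j - m)"
    have "\<bar>fps_shift J ((f oo (fps_X + \<delta>)) - (\<Sum>j<J. taylor_coeff j f * \<delta> ^ j)) $ n\<bar>
        = \<bar>\<Sum>m=2..n+J. \<Sum>j=J..m. f $ m * ?T m j\<bar>"
      unfolding fps_shift_nth taylor_remainder_nth[OF \<delta>0 f(2,3)] ..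
    also have "\<dots> \<le> (\<Sum>m=2..n+J. \<Sum>j=J..m. F * (?w m * \<bar>?T m j\<bar>))"
    proof (intro order_trans[OF sum_abs] sum_mono)
      fix m j
      show "\<bar>f $ m * ?T m j\<bar> \<le> F * (?w m * \<bar>?T m j\<bar>)"
        unfolding abs_mult[of "f $ m"] using F(2)[of m] by (simp only: mult.assoc[symmetric] mult_right_mono abs_ge_zero)
    qed
    also have "\<dots> = F * (\<Sum>m=2..n+J. \<Sum>j=J..m. ?w m * (real (m choose j) * \<bar>(\<delta> ^ j) $ (n + J + j - m)\<bar>))"
      by (simp add: sum_distrib_left abs_mult)
    also have "\<dots> \<le> F * (C * ?w n)"
      using C(2)[OF J, of "n + J"] F by (intro mult_left_mono) auto
    finally show "\<bar>fps_shift J ((f oo (fps_X + \<delta>)) - (\<Sum>j<J. taylor_coeff j f * \<delta> ^ j)) $ n\<bar> \<le> (F * C) * ?w n"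
      by (simp add: mult_ac)
  qed
qed

lemma fps_eq_linear_part_plus:
  fixes f :: "real fps"
  obtains r where "f = fps_const (f $ 0) + fps_const (f $ Suc 0) * fps_X + r"
    "r $ 0 = 0" "r $ Suc 0 = 0"
  using that[of "f - fps_const (f $ 0) - fps_const (f $ Suc 0) * fps_X"] by simp

lemma wt_bounded_compose_tangent2:
  assumes pos: "\<alpha> > 0" "\<beta> > 0" and \<delta>: "\<delta> \<in> wt_bounded \<alpha> \<beta>" "fps_X ^ 3 dvd \<delta>"
    and f: "f \<in> wt_bounded \<alpha> \<beta>"
  shows "f oo (fps_X + \<delta>) \<in> wt_bounded \<alpha> \<beta>"
proof -
  have fin: "p \<in> wt_bounded \<alpha> \<beta>" if "fps_finite p" for p
    using wt_small_finite[OF pos that, of 0] by simp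
  obtain r where r: "f = fps_const (f $ 0) + fps_const (f $ Suc 0) * fps_X + r" "r $ 0 = 0" "r $ Suc 0 = 0"
    using fps_eq_linear_part_plus .
  have "f - (fps_const (f $ 0) + fps_const (f $ Suc 0) * fps_X) \<in> wt_bounded \<alpha> \<beta>"
    by (intro wt_bounded_diff f fin) simp
  also have "f - (fps_const (f $ 0) + fps_const (f $ Suc 0) * fps_X) = r" using r(1) by (simp add: algebra_simps)
  finally have rB: "r \<in> wt_bounded \<alpha> \<beta>" .
  have "(r oo (fps_X + \<delta>)) - r \<in> wt_small \<alpha> \<beta> 0"
    using taylor_remainder_small[OF pos \<delta> rB r(2,3), of 1]
    by (intro wt_small_antimono[OF pos, of 0 1]) (simp_all add: lessThan_Suc)
  then have "r oo (fps_X + \<delta>) \<in> wt_bounded \<alpha> \<beta>" using wt_bounded_add[of _ \<alpha> \<beta> r] rB by (metis diff_add_cancel wt_small_0)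
  moreover have "\<delta> $ 0 = 0" using \<delta>(2) by (simp add: fps_X_power_dvd_iff_nth)
  then have "f oo (fps_X + \<delta>) = fps_const (f $ 0) + fps_const (f $ Suc 0) * (fps_X + \<delta>) + (r oo (fps_X + \<delta>))"
    by (subst r(1)) (simp add: fps_compose_add_distrib fps_compose_mult_distrib)
  moreover have "fps_const (f $ 0) + fps_const (f $ Suc 0) * (fps_X + \<delta>) \<in> wt_bounded \<alpha> \<beta>"
    by (intro wt_bounded_add[OF fin wt_bounded_mult[OF pos fin wt_bounded_add[OF fin \<delta>(1)]]]) auto
  ultimately show ?thesis using wt_bounded_add by fastforce
qed

text \<open>Each derivative costs a factor x^2, that is, two units of \<beta>. Existence is enough
  here: the composed expansion is identified later by a differential equation.\<close>

lemma fact_asymp_taylor_coeff: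
  assumes pos: "\<alpha> > 0" "\<beta> > 0" and f: "fact_asymp \<alpha> \<beta> f c"
  shows "\<exists>d. fact_asymp \<alpha> (\<beta> + real (2 * j)) (taylor_coeff j f) d"
proof (induction j)
  case 0
  then show ?case using f by auto
next
  case (Suc j)
  then obtain d where d: "fact_asymp \<alpha> (\<beta> + real (2 * j)) (taylor_coeff j f) d" by blast
  have pos': "\<beta> + real (2 * j) > 0" using pos by simp
  obtain e where "fact_asymp \<alpha> (\<beta> + real (2 * j)) (fps_X ^ 2 * fps_deriv (taylor_coeff j f)) e"
    using fact_asymp_X2_deriv[OF pos(1) pos' d] by blast
  then have "fact_asymp \<alpha> (\<beta> + real (2 * j) + real 2) (fps_deriv (taylor_coeff j f)) e"
    using fact_asymp_X_power_mult_iff[OF pos(1) pos'] by blast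
  also have "\<beta> + real (2 * j) + real 2 = \<beta> + real (2 * Suc j)" by simp
  finally have "fact_asymp \<alpha> (\<beta> + real (2 * Suc j)) (taylor_coeff (Suc j) f)
      (fps_const (1 / real (Suc j)) * e)"
    unfolding taylor_coeff_Suc using pos by (intro fact_asymp_finite_mult) auto
  then show ?case by blast
qed

text \<open>The loss of 2 j units of \<beta> in the j-th derivative is repaid by the factor x^(2 j)
  in \<delta>^j; the remaining factors of x make the expansion start at order j.\<close>

lemma fact_asymp_taylor_term:
  assumes pos: "\<alpha> > 0" "\<beta> > 0" and \<delta>: "fact_asymp \<alpha> \<beta> \<delta> H" "fps_X ^ 3 dvd \<delta>"
    and f: "fact_asymp \<alpha> \<beta> f c" "f $ Suc 0 = 0" and j: "j \<ge> 1"
  shows "\<exists>d. fact_asymp \<alpha> \<beta> (taylor_coeff j f * \<delta> ^ j) d \<and> fps_X ^ j dvd d"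
proof -
  let ?\<gamma> = "\<beta> + real (2 * j)"
  obtain v where v: "\<delta> = fps_X ^ 2 * v" and Xv: "fps_X dvd v"
  proof -
    obtain u where "\<delta> = fps_X ^ 3 * u" using \<delta>(2) by blast
    then show ?thesis using that[of "fps_X * u"] by (simp add: power3_eq_cube power2_eq_square mult.assoc)
  qed
  have "fact_asymp \<alpha> (\<beta> + real 2) v H"
    using \<delta>(1) fact_asymp_X_power_mult_iff[OF pos] unfolding v by blast
  then have "fact_asymp \<alpha> (\<beta> + real 2) (v ^ j) (of_nat j * v ^ (j - 1) * H)"
    using pos by (intro fact_asymp_power) auto
  then have "fact_asymp \<alpha> (\<beta> + real 2 + real (2 * j - 2)) (v ^ j)
      (fps_X ^ (2 * j - 2) * (of_nat j * v ^ (j - 1) * H))"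
    using pos by (intro fact_asymp_raise) auto
  also have "\<beta> + real 2 + real (2 * j - 2) = ?\<gamma>" using j by (simp add: of_nat_diff)
  finally have vj: "fact_asymp \<alpha> ?\<gamma> (v ^ j) (fps_X ^ (2 * j - 2) * (of_nat j * v ^ (j - 1) * H))" .
  obtain d where d: "fact_asymp \<alpha> ?\<gamma> (taylor_coeff j f) d"
    using fact_asymp_taylor_coeff[OF pos f(1)] by blast
  define e where "e = taylor_coeff j f * (fps_X ^ (2 * j - 2) * (of_nat j * v ^ (j - 1) * H)) + d * v ^ j"
  have "fact_asymp \<alpha> ?\<gamma> (taylor_coeff j f * v ^ j) e"
    unfolding e_def using pos by (intro fact_asymp_mult d vj) auto
  then have "fact_asymp \<alpha> \<beta> (fps_X ^ (2 * j) * (taylor_coeff j f * v ^ j)) e"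
    using fact_asymp_X_power_mult_iff[OF pos] by blast
  also have "fps_X ^ (2 * j) * (taylor_coeff j f * v ^ j) = taylor_coeff j f * \<delta> ^ j"
    by (simp add: v power_mult_distrib mult_ac flip: power_mult)
  finally have "fact_asymp \<alpha> \<beta> (taylor_coeff j f * \<delta> ^ j) e" .
  moreover have "fps_X ^ j dvd e"
  proof -
    \<comment> \<open>For j at least 2 the power x^(2 j - 2) suffices. For j = 1 it is trivial, and
      the missing factor x comes from f'(0) = 0.\<close>
    have "fps_X ^ j dvd taylor_coeff j f * fps_X ^ (2 * j - 2)"
    proof (cases "j = 1")
      case True
      have "fps_X ^ 1 dvd taylor_coeff 1 f" using f(2) unfolding fps_X_power_dvd_iff_nth by (simp add: taylor_coeff_def)
      then show ?thesis using True by simp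
    next
      case False
      then have "(fps_X :: real fps) ^ j dvd fps_X ^ (2 * j - 2)" using j by (intro le_imp_power_dvd) auto
      then show ?thesis by (rule dvd_mult)
    qed
    moreover have "fps_X ^ j dvd v ^ j" using Xv by (rule dvd_power_same)
    ultimately have "fps_X ^ j dvd (taylor_coeff j f * fps_X ^ (2 * j - 2)) * (of_nat j * v ^ (j - 1) * H) + d * v ^ j"
      by (intro dvd_add[OF dvd_mult2 dvd_mult])
    then show ?thesis by (simp add: e_def mult.assoc)
  qed
  ultimately show ?thesis by blast
qed

text \<open>The expansions of the Taylor terms start at increasing orders, so their sum converges
  x-adically. Only the term j = 0, with expansion \<open>c\<close>, reaches the constant
  coefficient.\<close>

lemma fact_asymp_compose_tangent2:
  assumes pos: "\<alpha> > 0" "\<beta> > 0" and \<delta>: "fact_asymp \<alpha> \<beta> \<delta> H" "fps_X ^ 3 dvd \<delta>"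
    and f: "fact_asymp \<alpha> \<beta> f c" "f $ 0 = 0" "f $ Suc 0 = 0"
  shows "\<exists>Y. fact_asymp \<alpha> \<beta> (f oo (fps_X + \<delta>)) Y \<and> Y $ 0 = c $ 0"
proof -
  have "\<exists>d. fact_asymp \<alpha> \<beta> (taylor_coeff j f * \<delta> ^ j) d \<and> fps_X ^ j dvd d \<and> (j = 0 \<longrightarrow> d = c)" for j
    using fact_asymp_taylor_term[OF pos \<delta> f(1,3), of j] f(1) by (cases "j = 0") auto
  then obtain d where d: "\<And>j. fact_asymp \<alpha> \<beta> (taylor_coeff j f * \<delta> ^ j) (d j)"
    "\<And>j. fps_X ^ j dvd d j" "d 0 = c" by metis
  define Y where "Y = Abs_fps (\<lambda>k. \<Sum>j\<le>k. d j $ k)"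
  have "fact_asymp \<alpha> \<beta> (f oo (fps_X + \<delta>)) Y"
  proof (rule fact_asympI[OF pos])
    fix R
    let ?t = "\<lambda>J. \<Sum>j<J. taylor_coeff j f * \<delta> ^ j" and ?d = "\<lambda>J. \<Sum>j<J. d j"
    have "fact_asymp \<alpha> \<beta> (?t J) (?d J)" for J
    proof (induction J)
      case 0
      then show ?case using fact_asymp_finite[OF pos fps_finite_const[of 0]] by simp
    next
      case (Suc J)
      from fact_asymp_add[OF this d(1)[of J]] show ?case by simp
    qed
    from fact_asympD[OF this, of "Suc R" R]
    have 1: "?t (Suc R) - fps_cutoff R (?d (Suc R)) * wt_base \<alpha> \<beta> \<in> wt_small \<alpha> \<beta> R" .
    \<comment> \<open>One term more than \<open>R\<close> is taken because the remainder estimate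
      requires at least one term.\<close>
    have "(f oo (fps_X + \<delta>)) - ?t (Suc R) \<in> wt_small \<alpha> \<beta> (Suc R)"
      by (intro taylor_remainder_small[OF pos] \<delta>(2) f(2,3)) (use \<delta> f fact_asymp_bounded in auto)
    then have 2: "(f oo (fps_X + \<delta>)) - ?t (Suc R) \<in> wt_small \<alpha> \<beta> R"
      by (rule wt_small_antimono[OF pos, rotated]) simp
    have 3: "(f oo (fps_X + \<delta>)) - fps_cutoff R (?d (Suc R)) * wt_base \<alpha> \<beta> \<in> wt_small \<alpha> \<beta> R"
      using wt_small_add[OF 2 1] by (simp only: diff_add_cancel add_diff_eq)
    have "fps_cutoff R (?d (Suc R)) $ k = Y $ k" if "k < R" for k
    proof -
      have "(\<Sum>j<Suc R. d j $ k) = (\<Sum>j\<le>k. d j $ k)"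
      proof (rule sum.mono_neutral_right)
        show "\<forall>j\<in>{..<Suc R} - {..k}. d j $ k = 0"
          using d(2) by (auto simp: fps_X_power_dvd_iff_nth)
      qed (use that in auto)
      then show ?thesis using that by (simp add: Y_def fps_sum_nth del: sum.lessThan_Suc)
    qed
    then have "fps_X ^ R dvd fps_cutoff R (?d (Suc R)) - Y" by (simp add: fps_X_power_dvd_iff_nth)
    with 3 show "\<exists>p. fps_finite p \<and> fps_X ^ R dvd p - Y
        \<and> (f oo (fps_X + \<delta>)) - p * wt_base \<alpha> \<beta> \<in> wt_small \<alpha> \<beta> R"
      by (intro exI[of _ "fps_cutoff R (?d (Suc R))"]) auto
  qed
  moreover have "Y $ 0 = c $ 0" by (simp add: Y_def d(3))
  ultimately show ?thesis by blast
qed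

text \<open>The linear part of G is split off to satisfy the vanishing conditions. Composed with x +
  \<delta> it contributes G_1 times the expansion of \<delta>, which explains the extra constant
  term.\<close>

lemma fact_asymp_base_compose_tangent2:
  assumes pos: "\<alpha> > 0" "\<beta> > 0" and \<delta>: "fact_asymp \<alpha> \<beta> \<delta> H" "fps_X ^ 3 dvd \<delta>"
  shows "\<exists>Y. fact_asymp \<alpha> \<beta> (wt_base \<alpha> \<beta> oo (fps_X + \<delta>)) Y
    \<and> Y $ 0 = 1 + wt_base \<alpha> \<beta> $ 1 * H $ 0"
proof -
  let ?G = "wt_base \<alpha> \<beta>"
  let ?l = "fps_const (?G $ 0) + fps_const (?G $ Suc 0) * fps_X"
  obtain r where r: "?G = ?l + r" "r $ 0 = 0" "r $ Suc 0 = 0"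
    using fps_eq_linear_part_plus .
  have "fact_asymp \<alpha> \<beta> (?G - ?l) (1 - 0)"
    by (intro fact_asymp_diff fact_asymp_base fact_asymp_finite pos) simp
  also have "?G - ?l = r" using r(1) by (metis add_diff_cancel_left')
  finally obtain Y where Y: "fact_asymp \<alpha> \<beta> (r oo (fps_X + \<delta>)) Y" "Y $ 0 = 1"
    using fact_asymp_compose_tangent2[OF pos \<delta> _ r(2,3), of 1] by auto
  have "fact_asymp \<alpha> \<beta> (?l + fps_const (?G $ Suc 0) * \<delta> + (r oo (fps_X + \<delta>)))
      (0 + fps_const (?G $ Suc 0) * H + Y)"
    by (intro fact_asymp_add fact_asymp_finite_mult \<delta> Y(1) pos)
      (auto intro!: fact_asymp_finite pos simp del: wt_base_nth)
  moreover have "?G oo (fps_X + \<delta>) = ?l + fps_const (?G $ Suc 0) * \<delta> + (r oo (fps_X + \<delta>))"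
  proof -
    have "\<delta> $ 0 = 0" using \<delta>(2) by (simp add: fps_X_power_dvd_iff_nth)
    then have "?l + r oo (fps_X + \<delta>) = ?l + fps_const (?G $ Suc 0) * \<delta> + (r oo (fps_X + \<delta>))"
      by (simp add: fps_compose_add_distrib fps_compose_mult_distrib algebra_simps del: wt_base_nth)
    then show ?thesis
      by (rule trans[OF arg_cong[OF r(1), of "\<lambda>u. u oo (fps_X + \<delta>)"]])
  qed
  ultimately show ?thesis
    using Y(2) by (intro exI[of _ "0 + fps_const (?G $ Suc 0) * H + Y"]) auto
qed

text \<open>The equation for \<open>k\<close> is a recurrence expressing k_n through \<delta>_n and
  earlier coefficients. By the tail bound with J = 1 the earlier ones enter with total weight of
  order w(n - 1), which is eventually a small fraction of w(n).\<close>

lemma compose_inverse_tangent2_bounded: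
  assumes pos: "\<alpha> > 0" "\<beta> > 0" and \<delta>: "\<delta> \<in> wt_bounded \<alpha> \<beta>" "fps_X ^ 3 dvd \<delta>"
    and k: "k oo (fps_X + \<delta>) = fps_X" "k $ 0 = 0" "k $ Suc 0 = 1"
  shows "k \<in> wt_bounded \<alpha> \<beta>"
proof -
  let ?w = "wt \<alpha> \<beta>"
  obtain C where C: "C > 0" "\<And>J n. 1 \<le> J \<Longrightarrow> J \<le> n \<Longrightarrow>
      (\<Sum>m=2..n. \<Sum>j=J..m. ?w m * (real (m choose j) * \<bar>(\<delta> ^ j) $ (n + j - m)\<bar>)) \<le> C * ?w (n - J)"
    using taylor_tail_bound[OF pos \<delta>] by blast
  obtain D where D: "D > 0" "\<And>n. \<bar>\<delta> $ n\<bar> \<le> D * ?w n" using wt_boundedE[OF \<delta>(1) pos] by blast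
  have \<delta>0: "\<delta> $ 0 = 0" using \<delta>(2) by (simp add: fps_X_power_dvd_iff_nth)
  have \<delta>j: "(\<delta> ^ j) $ j = 0" if "j \<ge> 1" for j
  proof -
    have "fps_X ^ (3 * j) dvd \<delta> ^ j" unfolding power_mult by (rule dvd_power_same[OF \<delta>(2)])
    then show ?thesis using that by (simp add: fps_X_power_dvd_iff_nth)
  qed
  \<comment> \<open>Taylor expansion with J = 1 of k - x, whose first two coefficients vanish and
    which (x + \<delta>) sends to -\<delta>.\<close>
  have rec: "- k $ n = \<delta> $ n + (\<Sum>m=2..n. \<Sum>j=1..m. k $ m * (real (m choose j) * (\<delta> ^ j) $ (n + j - m)))"
    if "n \<ge> 2" for n
  proof -
    have "(((k - fps_X) oo (fps_X + \<delta>)) - (\<Sum>j<1. taylor_coeff j (k - fps_X) * \<delta> ^ j)) $ n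
        = (\<Sum>m=2..n. \<Sum>j=1..m. (k - fps_X) $ m * (real (m choose j) * (\<delta> ^ j) $ (n + j - m)))"
      by (rule taylor_remainder_nth) (use \<delta>0 k in auto)
    also have "\<dots> = (\<Sum>m=2..n. \<Sum>j=1..m. k $ m * (real (m choose j) * (\<delta> ^ j) $ (n + j - m)))"
      by (intro sum.cong) auto
    also have "((k - fps_X) oo (fps_X + \<delta>)) - (\<Sum>j<1. taylor_coeff j (k - fps_X) * \<delta> ^ j) = fps_X - \<delta> - k"
      using \<delta>0 by (simp add: fps_compose_sub_distrib k(1) lessThan_Suc)
    finally show ?thesis using that by simp
  qed
  \<comment> \<open>Beyond \<open>N\<close> one has C w(n - 1) at most w(n) / 2. Half of the bound
    \<open>K\<close> thus covers the sum, and K at least 2 D leaves the other half for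
    \<delta>_n.\<close>
  obtain N where N: "real N \<ge> 2 * C / \<alpha>" "N \<ge> 2"
    using real_arch_simple[of "max 2 (2 * C / \<alpha>)"] by auto
  define K where "K = max (2 * D) (Max ((\<lambda>n. \<bar>k $ n\<bar> / ?w n) ` {..N}))"
  have K: "K \<ge> 2 * D" "K > 0" using D by (auto simp: K_def)
  have "\<bar>k $ n\<bar> \<le> K * ?w n" for n
  proof (induction n rule: less_induct)
    case (less n)
    show ?case
    proof (cases "n \<le> N")
      case True
      then have "\<bar>k $ n\<bar> / ?w n \<le> Max ((\<lambda>n. \<bar>k $ n\<bar> / ?w n) ` {..N})" by (intro Max_ge) auto
      then have "\<bar>k $ n\<bar> / ?w n \<le> K" by (simp add: K_def)
      then show ?thesis using pos by (simp add: divide_le_eq)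
    next
      case False
      then have n: "n \<ge> 2" "n > N" using N by auto
      let ?T = "\<lambda>m j. real (m choose j) * (\<delta> ^ j) $ (n + j - m)"
      have "\<bar>k $ n\<bar> = \<bar>- k $ n\<bar>" by simp
      also have "\<dots> \<le> \<bar>\<delta> $ n\<bar> + \<bar>\<Sum>m=2..n. \<Sum>j=1..m. k $ m * ?T m j\<bar>"
        unfolding rec[OF n(1)] by (rule abs_triangle_ineq)
      also have "\<bar>\<Sum>m=2..n. \<Sum>j=1..m. k $ m * ?T m j\<bar> \<le> (\<Sum>m=2..n. \<Sum>j=1..m. K * (?w m * \<bar>?T m j\<bar>))"
      proof (intro order_trans[OF sum_abs] sum_mono)
        fix m j assume mj: "m \<in> {2..n}" "j \<in> {1..m}"
        show "\<bar>k $ m * ?T m j\<bar> \<le> K * (?w m * \<bar>?T m j\<bar>)"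
        \<comment> \<open>The diagonal terms vanish as \<delta>^j has order above j, so the
          induction hypothesis is used only for m < n.\<close>
        proof (cases "m = n")
          case True
          then show ?thesis using \<delta>j mj by simp
        next
          case False
          then have "\<bar>k $ m\<bar> \<le> K * ?w m" using less[of m] mj by simp
          then show ?thesis unfolding abs_mult[of "k $ m"]
            by (simp only: mult.assoc[symmetric] mult_right_mono abs_ge_zero)
        qed
      qed
      also have "(\<Sum>m=2..n. \<Sum>j=1..m. K * (?w m * \<bar>?T m j\<bar>))
          = K * (\<Sum>m=2..n. \<Sum>j=1..m. ?w m * (real (m choose j) * \<bar>(\<delta> ^ j) $ (n + j - m)\<bar>))"
        by (simp add: sum_distrib_left abs_mult)
      also have "\<dots> \<le> K * (C * ?w (n - 1))"
        using C(2)[of 1 n] n K by (intro mult_left_mono) auto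
      also have "\<dots> \<le> K * (?w n / 2)"
      proof (rule mult_left_mono)
        obtain m where m: "n = Suc m" "m \<ge> N" using n by (cases n) auto
        have "2 * C / \<alpha> \<le> real m + \<beta>" using N(1) m(2) pos by linarith
        then have "2 * C \<le> \<alpha> * (real m + \<beta>)" using pos by (simp add: field_simps)
        then have "2 * C * ?w m \<le> \<alpha> * (real m + \<beta>) * ?w m"
          using pos by (intro mult_right_mono) auto
        then show "C * ?w (n - 1) \<le> ?w n / 2" using m pos by (simp add: wt_Suc)
      qed (use K in simp)
      also have "\<bar>\<delta> $ n\<bar> \<le> K * (?w n / 2)"
      proof -
        have "D * ?w n \<le> K / 2 * ?w n" using K pos by (intro mult_right_mono) auto
        then show ?thesis using D(2)[of n] by simp
      qed
      finally show ?thesis by simp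
    qed
  qed
  then show ?thesis by (rule wt_boundedI)
qed

section \<open>Reduction of composition to the base series\<close>

lemma fps_X_power_dvd_compose:
  assumes "g $ 0 = 0" "fps_X ^ R dvd (v :: real fps)"
  shows "fps_X ^ R dvd (v oo g)"
proof -
  obtain q where "v = fps_X ^ R * q" using assms by blast
  then have "v oo g = g ^ R * (q oo g)"
    using assms(1) by (simp add: fps_compose_mult_distrib flip: fps_compose_power)
  moreover have "fps_X dvd g"
    using assms(1) fps_X_power_dvd_iff_nth[of 1 g] by simp
  ultimately show ?thesis by (simp add: dvd_power_same)
qed

text \<open>Write v = x^(R+1) b and g = x g'. Then \<open>b\<close> and g' are bounded at \<beta> +
  1, and so is g'^(R+1) (b o g). Of the factor x^(R+1), one x returns from \<beta> + 1 to \<beta>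
  and x^R gives the order of the remainder.\<close>

lemma wt_small_compose:
  assumes pos: "\<alpha> > 0" "\<beta> > 0" and g: "g $ 0 = 0" "g \<in> wt_bounded \<alpha> \<beta>"
    and comp: "\<And>f. f \<in> wt_bounded \<alpha> (\<beta> + 1) \<Longrightarrow> f oo g \<in> wt_bounded \<alpha> (\<beta> + 1)"
    and v: "v \<in> wt_small \<alpha> \<beta> R" "fps_X ^ Suc R dvd v"
  shows "v oo g \<in> wt_small \<alpha> \<beta> R"
proof -
  have X_mult: "fps_X ^ R * (fps_X ^ 1 * b) \<in> wt_small \<alpha> \<beta> R \<longleftrightarrow> b \<in> wt_bounded \<alpha> (\<beta> + 1)" for b
    using wt_small_X_power_mult[of R "fps_X ^ 1 * b" \<alpha> \<beta> 0] wt_bounded_X_power_mult_iff[OF pos, of 1 b]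
    by simp
  obtain b where b: "v = fps_X ^ Suc R * b" using v by blast
  have bB: "b \<in> wt_bounded \<alpha> (\<beta> + 1)"
    using v(1) X_mult[of b] by (simp add: b mult_ac)
  obtain g' where g': "g = fps_X * g'"
    using g(1) fps_X_power_dvd_iff_nth[of 1 g] by auto
  have g'B: "g' \<in> wt_bounded \<alpha> (\<beta> + 1)"
    using g(2) wt_bounded_X_power_mult_iff[OF pos, of 1 g'] by (simp add: g')
  have "v oo g = g ^ Suc R * (b oo g)"
    unfolding b using g(1) by (simp only: fps_compose_mult_distrib fps_X_fps_compose_startby0 flip: fps_compose_power)
  also have "\<dots> = fps_X ^ R * (fps_X ^ 1 * (g' ^ Suc R * (b oo g)))"
    by (subst (1) g') (simp add: power_mult_distrib mult_ac)
  also have "\<dots> \<in> wt_small \<alpha> \<beta> R"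
    unfolding X_mult using pos by (intro wt_bounded_mult wt_bounded_power g'B comp bB) auto
  finally show ?thesis .
qed

lemma fact_asymp_finite_compose:
  assumes pos: "\<alpha> > 0" "\<beta> > 0" and g: "g $ 0 = 0" "fact_asymp \<alpha> \<beta> g H" and p: "fps_finite p"
  shows "fact_asymp \<alpha> \<beta> (p oo g) ((fps_deriv p oo g) * H)"
proof -
  have "fact_asymp \<alpha> \<beta> (fps_cutoff N p oo g) ((fps_deriv (fps_cutoff N p) oo g) * H)" for N
  proof (induction N)
    case 0
    then show ?case using fact_asymp_finite[OF pos fps_finite_const[of 0]] by simp
  next
    case (Suc N)
    have eq: "fps_cutoff (Suc N) p = fps_cutoff N p + fps_const (p $ N) * fps_X ^ N"
      by (auto simp: fps_eq_iff less_Suc_eq)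
    have "fact_asymp \<alpha> \<beta> (fps_const (p $ N) * g ^ N) (fps_const (p $ N) * (of_nat N * g ^ (N - 1) * H))"
      using pos by (intro fact_asymp_finite_mult fact_asymp_power g) auto
    from fact_asymp_add[OF Suc this] show ?case
      unfolding eq using g(1)
      by (simp add: fps_compose_add_distrib fps_compose_mult_distrib fps_deriv_power
          distrib_right mult.assoc flip: fps_compose_power fps_of_nat)
  qed
  then show ?thesis using p unfolding fps_finite_def by metis
qed

lemma fps_X_power_dvd_deriv:
  "fps_X ^ Suc R dvd (v :: real fps) \<Longrightarrow> fps_X ^ R dvd fps_deriv v"
  by (simp add: fps_X_power_dvd_iff_nth del: power_Suc)

text \<open>Modulo the remainder space \<open>f\<close> is a polynomial multiple of G plus a
  polynomial. Polynomials compose by the chain rule, so the expansion \<open>Y\<close> of G o g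
  determines that of f o g.\<close>

lemma fact_asymp_compose_via_base:
  assumes pos: "\<alpha> > 0" "\<beta> > 0" and g: "g $ 0 = 0" "fact_asymp \<alpha> \<beta> g H"
    and comp: "\<And>f. f \<in> wt_bounded \<alpha> (\<beta> + 1) \<Longrightarrow> f oo g \<in> wt_bounded \<alpha> (\<beta> + 1)"
    and Y: "fact_asymp \<alpha> \<beta> (wt_base \<alpha> \<beta> oo g) Y"
    and f: "fact_asymp \<alpha> \<beta> f c"
  shows "fact_asymp \<alpha> \<beta> (f oo g)
    ((fps_deriv f oo g) * H + (Y - (fps_deriv (wt_base \<alpha> \<beta>) oo g) * H) * (c oo g))"
    (is "fact_asymp _ _ _ ?T")
proof (rule fact_asympI[OF pos])
  fix R
  let ?G = "wt_base \<alpha> \<beta>"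
  define p where "p = fps_cutoff R c"
  \<comment> \<open>Removing the low-order coefficients makes the remainder \<open>v\<close>
    divisible by x^(R+1), as substitution into a remainder requires.\<close>
  define s where "s = fps_cutoff (Suc R) (f - p * ?G)"
  define v where "v = f - p * ?G - s"
  have f_eq: "f = (p * ?G + s) + v" by (simp add: v_def)
  have p: "fps_finite p" "fps_X ^ R dvd p - c"
    unfolding p_def by (simp_all add: fps_X_power_dvd_cutoff_diff)
  have s: "fps_finite s" by (simp add: s_def)
  have "v \<in> wt_small \<alpha> \<beta> R"
    unfolding v_def p_def by (intro wt_small_diff fact_asympD f wt_small_finite pos s)
  moreover have v: "fps_X ^ Suc R dvd v"
    unfolding fps_X_power_dvd_iff_nth v_def s_def by simp
  ultimately have v_small: "v oo g \<in> wt_small \<alpha> \<beta> R"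
    using wt_small_compose[OF pos g(1) fact_asymp_bounded[OF g(2)] comp] by blast
  define e where "e = (p oo g) * Y + (fps_deriv p oo g) * H * (?G oo g) + (fps_deriv s oo g) * H"
  have e: "fact_asymp \<alpha> \<beta> ((p * ?G + s) oo g) e"
    unfolding e_def fps_compose_add_distrib fps_compose_mult_distrib[OF g(1)]
    by (intro fact_asymp_add fact_asymp_mult fact_asymp_finite_compose pos g p(1) s Y)
  have "fps_deriv f = fps_deriv p * ?G + p * fps_deriv ?G + fps_deriv s + fps_deriv v"
    by (subst f_eq) (simp add: algebra_simps)
  then have "e - ?T = ((p - c) oo g) * (Y - (fps_deriv ?G oo g) * H) - (fps_deriv v oo g) * H"
    unfolding e_def using g(1)
    by (simp add: fps_compose_add_distrib fps_compose_mult_distrib fps_compose_sub_distrib algebra_simps)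
  also have "fps_X ^ R dvd \<dots>"
    by (intro dvd_diff dvd_mult2 fps_X_power_dvd_compose g(1) p(2) fps_X_power_dvd_deriv v)
  finally have eT: "fps_X ^ R dvd e - ?T" .
  have "fps_X ^ R dvd fps_cutoff R e - ?T"
    using dvd_add[OF fps_X_power_dvd_cutoff_diff[of R e] eT] by (simp only: add_diff_eq diff_add_cancel)
  moreover have "(f oo g) - fps_cutoff R e * ?G \<in> wt_small \<alpha> \<beta> R"
  proof -
    have "f oo g = ((p * ?G + s) oo g) + (v oo g)"
      by (subst f_eq) (rule fps_compose_add_distrib)
    then show ?thesis using wt_small_add[OF fact_asympD[OF e, of R] v_small]
      by (simp add: algebra_simps)
  qed
  ultimately show "\<exists>p. fps_finite p \<and> fps_X ^ R dvd p - ?T \<and> (f oo g) - p * ?G \<in> wt_small \<alpha> \<beta> R"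
    using fps_finite_cutoff by blast
qed

lemma fact_asymp_compose_moebius:
  assumes pos: "\<alpha> > 0" "\<beta> > 0" and f: "fact_asymp \<alpha> \<beta> f c"
  shows "fact_asymp \<alpha> \<beta> (f oo moebius_fps a)
    ((fps_const (exp (a / \<alpha>)) * neg_binomial a (- \<beta>)) * (c oo moebius_fps a))"
proof -
  have "fact_asymp \<alpha> \<beta> (f oo moebius_fps a) ((fps_deriv f oo moebius_fps a) * 0
      + (fps_const (exp (a / \<alpha>)) * neg_binomial a (- \<beta>) - (fps_deriv (wt_base \<alpha> \<beta>) oo moebius_fps a) * 0)
        * (c oo moebius_fps a))"
    using pos by (intro fact_asymp_compose_via_base wt_bounded_compose_moebius fact_asymp_moebius
        fact_asymp_base_compose_moebius f) auto
  then show ?thesis by simp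
qed

section \<open>Composition with a series tangent to the identity\<close>

lemma fps_compose_nth_1: "(g :: real fps) $ 0 = 0 \<Longrightarrow> (f oo g) $ Suc 0 = f $ Suc 0 * g $ Suc 0"
  by (simp add: fps_compose_nth)

lemma fps_compose_nth_2:
  assumes "(g :: real fps) $ 0 = 0"
  shows "(f oo g) $ 2 = f $ Suc 0 * g $ 2 + f $ 2 * (g $ Suc 0)\<^sup>2"
  using assms
  by (simp add: fps_compose_nth numeral_2_eq_2 fps_mult_nth sum.atLeast_Suc_atMost power2_eq_square)

lemma tangent_eq_X_plus:
  assumes "(h :: real fps) $ 0 = 0" "h $ Suc 0 = 1" "h $ 2 = 0"
  obtains \<delta> where "h = fps_X + \<delta>" "fps_X ^ 3 dvd \<delta>"
proof
  show "h = fps_X + (h - fps_X)" by simp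
  show "fps_X ^ 3 dvd h - fps_X"
    unfolding fps_X_power_dvd_iff_nth using assms by (auto simp: less_Suc_eq numeral_3_eq_3 numeral_2_eq_2)
qed

text \<open>Substituting the Moebius series with parameter -g_2 cancels the x^2 coefficient, and the
  one with parameter g_2 undoes this.\<close>

lemma tangent_moebius_decomposition:
  assumes "(g :: real fps) $ 0 = 0" "g $ Suc 0 = 1"
  obtains h where "h = g oo moebius_fps (- (g $ 2))" "g = h oo moebius_fps (g $ 2)"
    "h $ 0 = 0" "h $ Suc 0 = 1" "h $ 2 = 0"
proof
  let ?a = "g $ 2"
  show "g = (g oo moebius_fps (- ?a)) oo moebius_fps ?a"
    using moebius_compose_inverse[of "- ?a"] by (simp flip: fps_compose_assoc)
qed (use assms in \<open>simp_all add: fps_compose_nth_1 fps_compose_nth_2 moebius_nth_2\<close>)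

lemma fact_asymp_base_compose_tangent:
  assumes pos: "\<alpha> > 0" "\<beta> > 0" and g: "g $ 0 = 0" "g $ Suc 0 = 1" "fact_asymp \<alpha> \<beta> g H"
  shows "\<exists>Y. fact_asymp \<alpha> \<beta> (wt_base \<alpha> \<beta> oo g) Y
    \<and> (Y - (fps_deriv (wt_base \<alpha> \<beta>) oo g) * H) $ 0 = exp (g $ 2 / \<alpha>)"
    and "f \<in> wt_bounded \<alpha> (\<beta> + 1) \<Longrightarrow> f oo g \<in> wt_bounded \<alpha> (\<beta> + 1)"
proof -
  let ?a = "g $ 2" and ?G = "wt_base \<alpha> \<beta>"
  let ?E = "fps_const (exp (?a / \<alpha>)) * neg_binomial ?a (- \<beta>)"
  obtain h where h: "h = g oo moebius_fps (- ?a)" "g = h oo moebius_fps ?a"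
    "h $ 0 = 0" "h $ Suc 0 = 1" "h $ 2 = 0"
    using tangent_moebius_decomposition[OF g(1,2)] .
  obtain \<delta> where \<delta>: "h = fps_X + \<delta>" "fps_X ^ 3 dvd \<delta>"
    using tangent_eq_X_plus[OF h(3-5)] .
  obtain Hh where Hh: "fact_asymp \<alpha> \<beta> h Hh"
    using fact_asymp_compose_moebius[OF pos g(3)] unfolding h(1) by blast
  have "fact_asymp \<alpha> \<beta> (h - fps_X) (Hh - 0)"
    by (intro fact_asymp_diff Hh fact_asymp_finite pos fps_finite_X)
  then have \<delta>_asymp: "fact_asymp \<alpha> \<beta> \<delta> Hh" by (simp add: \<delta>(1))
  have comp: "f oo g = (f oo h) oo moebius_fps ?a" for f
    by (subst h(2)) (rule fps_compose_assoc, use h in simp_all)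
  {
    assume f: "f \<in> wt_bounded \<alpha> (\<beta> + 1)"
    have "\<delta> \<in> wt_bounded \<alpha> (\<beta> + 1)"
      using fact_asymp_bounded[OF \<delta>_asymp] wt_bounded_mono[OF pos, of 1] by auto
    then show "f oo g \<in> wt_bounded \<alpha> (\<beta> + 1)"
      unfolding comp \<delta>(1) using pos \<delta>(2) f
      by (intro wt_bounded_compose_moebius wt_bounded_compose_tangent2) auto
  }
  obtain Y where Y: "fact_asymp \<alpha> \<beta> (?G oo h) Y" "Y $ 0 = 1 + ?G $ 1 * Hh $ 0"
    using fact_asymp_base_compose_tangent2[OF pos \<delta>_asymp \<delta>(2)] unfolding \<delta>(1) by blast
  have "fact_asymp \<alpha> \<beta> g (?E * (Hh oo moebius_fps ?a))"
    by (subst h(2)) (rule fact_asymp_compose_moebius[OF pos Hh])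
  then have H: "H = ?E * (Hh oo moebius_fps ?a)" using fact_asymp_unique[OF pos g(3)] by blast
  have "fact_asymp \<alpha> \<beta> (?G oo g) (?E * (Y oo moebius_fps ?a))"
    unfolding comp by (rule fact_asymp_compose_moebius[OF pos Y(1)])
  \<comment> \<open>The term with G_1 that \<delta> contributes to \<open>Y\<close> cancels against
    the subtracted one; both carry the factor exp (a / \<alpha>).\<close>
  moreover have "(?E * (Y oo moebius_fps ?a) - (fps_deriv ?G oo g) * H) $ 0 = exp (?a / \<alpha>)"
    unfolding H using Y(2) by (simp add: algebra_simps)
  ultimately show "\<exists>Y. fact_asymp \<alpha> \<beta> (?G oo g) Y
      \<and> (Y - (fps_deriv ?G oo g) * H) $ 0 = exp (?a / \<alpha>)" by blast
qed

section \<open>A linear differential equation for the expansion of G o g\<close>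

lemma base_compose_ODE_ring:
  fixes A iA B X g g' y G1 G1' H H' Y Y' c0 :: "'a :: idom"
  assumes "A * iA = 1"
    and "A * g * g * (iA * Y - B * X * Y + X * X * Y') + A * (g * H + H * g) * (X * X * (G1 * g'))
      = X * X * g' * ((1 - A * B * g) * Y - A * B * H * y) + (iA * H - B * X * H + X * X * H') * ((1 - A * B * g) * y - c0)"
    and "A * g * g * G1 = (1 - A * B * g) * y - c0"
    and "A * ((g * g' + g' * g) * G1 + g * g * G1') = (1 - A * B * g) * (G1 * g') - A * B * g' * y"
  shows "A * X * X * g * g * (Y' - G1' * H - G1 * H')
      = (X * X * g' * (1 - A * B * g) - g * g * (1 - A * B * X)) * (Y - G1 * H)" (is "?l = ?r")
proof -
  define N where "N = iA * H - B * X * H + X * X * H'"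
  \<comment> \<open>The difference is the second assumption minus multiples of the other three. The
    multipliers \<open>N\<close>, \<open>X * X * H\<close> and \<open>g * g * (Y - G1 * H)\<close>
    are those that cancel all terms outside the homogeneous equation.\<close>
  have "?l - ?r
      = ((A * g * g * (iA * Y - B * X * Y + X * X * Y') + A * (g * H + H * g) * (X * X * (G1 * g')))
          - (X * X * g' * ((1 - A * B * g) * Y - A * B * H * y) + N * ((1 - A * B * g) * y - c0)))
        - N * (A * g * g * G1 - ((1 - A * B * g) * y - c0))
        - X * X * H * (A * ((g * g' + g' * g) * G1 + g * g * G1') - ((1 - A * B * g) * (G1 * g') - A * B * g' * y))
        - g * g * (Y - G1 * H) * (A * iA - 1)"
    unfolding N_def by (simp add: algebra_simps)
  also have "\<dots> = 0"
    unfolding N_def by (simp only: assms(1,3,4) assms(2)) simp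
  finally show ?thesis by simp
qed

text \<open>The differential equation of G and the chain rule give an equation for y = G o g.
  Expanding both sides and using uniqueness relates \<open>Y\<close>, \<open>H\<close> and their
  derivatives, and the combination \<open>D\<close> absorbs every term with \<open>H\<close>,
  leaving a homogeneous equation.\<close>

lemma base_compose_ODE:
  assumes pos: "\<alpha> > 0" "\<beta> > 0" and g: "g $ 0 = 0" "fact_asymp \<alpha> \<beta> g H"
    and Y: "fact_asymp \<alpha> \<beta> (wt_base \<alpha> \<beta> oo g) Y"
  defines "D \<equiv> Y - (fps_deriv (wt_base \<alpha> \<beta>) oo g) * H"
  shows "fps_const \<alpha> * fps_X * fps_X * g * g * fps_deriv D
    = (fps_X * fps_X * fps_deriv g * (1 - fps_const \<alpha> * fps_const \<beta> * g)
        - g * g * (1 - fps_const \<alpha> * fps_const \<beta> * fps_X)) * D"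
proof -
  let ?G = "wt_base \<alpha> \<beta>"
  define A B iA where "A = fps_const \<alpha>" and "B = fps_const \<beta>" and "iA = fps_const (1 / \<alpha>)"
  define y where "y = ?G oo g"
  define G1 where "G1 = fps_deriv ?G oo g"
  define c0 where "c0 = fps_const (?G $ 0)"
  have AB: "A * B = fps_const (\<alpha> * \<beta>)" by (simp add: A_def B_def)
  have AiA: "A * iA = 1" using pos by (simp add: A_def iA_def)
  have y': "fps_deriv y = G1 * fps_deriv g" unfolding y_def G1_def by (rule fps_compose_deriv[OF g(1)])
  have ode: "A * g * g * G1 = (1 - A * B * g) * y - c0"
    unfolding AB using arg_cong[OF wt_base_ODE[OF pos], of "\<lambda>u. u oo g"] g(1)
    by (simp add: fps_compose_mult_distrib fps_compose_sub_distrib y_def G1_def c0_def A_def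
        power2_eq_square mult.assoc del: wt_base_nth fps_const_mult)
  have const: "fps_deriv A = 0" "fps_deriv B = 0" "fps_deriv c0 = 0"
    by (simp_all add: A_def B_def c0_def)
  have "A * ((g * fps_deriv g + fps_deriv g * g) * G1 + g * g * fps_deriv G1) = fps_deriv (A * g * g * G1)"
    by (simp add: const distrib_left distrib_right mult.assoc)
  also have "\<dots> = fps_deriv ((1 - A * B * g) * y - c0)" by (simp only: ode)
  also have "\<dots> = (1 - A * B * g) * (G1 * fps_deriv g) - A * B * fps_deriv g * y"
    by (simp add: const y')
  finally have ode': "A * ((g * fps_deriv g + fps_deriv g * g) * G1 + g * g * fps_deriv G1)
      = (1 - A * B * g) * (G1 * fps_deriv g) - A * B * fps_deriv g * y" .
  \<comment> \<open>Multiplication by \<alpha> g^2 lets the differential equation of G, taken at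
    \<open>g\<close>, replace the derivative of G. Both sides can be expanded by the Leibniz
    rule.\<close>
  have eq: "A * g * g * (fps_X * fps_X * fps_deriv y) = (fps_X * fps_X * fps_deriv g) * ((1 - A * B * g) * y - c0)"
    unfolding y' ode[symmetric] by (simp add: mult_ac)
  let ?N = "\<lambda>C. iA * C - B * fps_X * C + fps_X * fps_X * fps_deriv C"
  have N: "fact_asymp \<alpha> \<beta> (fps_X * fps_X * fps_deriv u) (?N C)" if "fact_asymp \<alpha> \<beta> u C" for u C
    using fact_asymp_X2_deriv[OF pos that] by (simp add: iA_def B_def power2_eq_square)
  have Ag: "fact_asymp \<alpha> \<beta> (A * g * g) (A * (g * H + H * g))"
    unfolding mult.assoc[of A] using pos g unfolding A_def
    by (intro fact_asymp_finite_mult fact_asymp_mult) auto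
  have lhs: "fact_asymp \<alpha> \<beta> (A * g * g * (fps_X * fps_X * fps_deriv y))
      (A * g * g * ?N Y + A * (g * H + H * g) * (fps_X * fps_X * fps_deriv y))"
    by (intro fact_asymp_mult pos Ag N) (use Y in \<open>simp add: y_def\<close>)
  have 1: "fact_asymp \<alpha> \<beta> (1 - A * B * g) (0 - A * B * H)"
    unfolding AB using pos g fact_asymp_finite[OF pos fps_finite_const[of 1]]
    by (intro fact_asymp_diff fact_asymp_finite_mult) auto
  have "fact_asymp \<alpha> \<beta> ((1 - A * B * g) * y - c0) (((1 - A * B * g) * Y + (0 - A * B * H) * y) - 0)"
    unfolding y_def c0_def
    by (intro fact_asymp_diff[OF fact_asymp_mult[OF pos 1 Y] fact_asymp_finite[OF pos fps_finite_const]])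
  then have rhs: "fact_asymp \<alpha> \<beta> ((fps_X * fps_X * fps_deriv g) * ((1 - A * B * g) * y - c0))
      ((fps_X * fps_X * fps_deriv g) * (((1 - A * B * g) * Y + (0 - A * B * H) * y) - 0)
        + ?N H * ((1 - A * B * g) * y - c0))"
    by (intro fact_asymp_mult pos N g)
  have main: "A * g * g * ?N Y + A * (g * H + H * g) * (fps_X * fps_X * (G1 * fps_deriv g))
      = fps_X * fps_X * fps_deriv g * ((1 - A * B * g) * Y - A * B * H * y) + ?N H * ((1 - A * B * g) * y - c0)"
    using fact_asymp_unique[OF pos lhs[unfolded eq] rhs] unfolding y' by simp
  have D: "D = Y - G1 * H" by (simp add: D_def G1_def)
  have D': "fps_deriv D = fps_deriv Y - fps_deriv G1 * H - G1 * fps_deriv H"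
    by (simp add: D algebra_simps)
  show ?thesis
    using base_compose_ODE_ring[OF AiA main ode ode'] unfolding D'[symmetric] D[symmetric] A_def B_def .
qed

text \<open>The quotient D / J has derivative zero and constant term 1. The factor \<open>P\<close>
  may vanish at 0, as it does in the application, and is cancelled in the integral domain.\<close>

lemma fps_linear_ODE_unique:
  fixes D J P Q :: "real fps"
  assumes D: "P * fps_deriv D = Q * D" and J: "P * fps_deriv J = Q * J"
    and "P \<noteq> 0" "D $ 0 = J $ 0" "J $ 0 \<noteq> 0"
  shows "D = J"
proof -
  define I where "I = inverse J"
  have JI: "J * I = 1" unfolding I_def using assms(5) by (simp add: inverse_mult_eq_1')
  have JI': "fps_deriv J * I + J * fps_deriv I = 0"
    using arg_cong[OF JI, of fps_deriv] by (simp add: algebra_simps)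
  have "P * (fps_deriv D * J - D * fps_deriv J) = (P * fps_deriv D) * J - D * (P * fps_deriv J)"
    by (simp add: algebra_simps)
  also have "\<dots> = 0" unfolding D J by (simp add: algebra_simps)
  finally have w: "fps_deriv D * J = D * fps_deriv J" using assms(3) by simp
  have "fps_deriv (D * I) * J * J = (fps_deriv D * J - D * fps_deriv J) * (J * I)
      + D * J * (fps_deriv J * I + J * fps_deriv I)"
    by (simp add: algebra_simps)
  also have "\<dots> = 0" by (simp add: w JI')
  finally have "fps_deriv (D * I) * J * J = 0" .
  moreover have "J \<noteq> 0" using assms(5) by auto
  ultimately have "fps_deriv (D * I) = 0" by simp
  then have "D * I = fps_const ((D * I) $ 0)" using fps_deriv_eq_0_iff by blast
  also have "(D * I) $ 0 = 1" using assms(4,5) by (simp add: I_def)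
  finally have "D * (J * I) = J" by (simp add: mult_ac)
  then show ?thesis by (simp add: JI)
qed

section \<open>The closed form of the factor and its differential equation\<close>

lemma fps_real_power_ODE:
  assumes "u $ 0 = 1"
  shows "u * fps_deriv (fps_real_power u b) = fps_const b * fps_deriv u * fps_real_power u b"
proof -
  have u0: "(u - 1) $ 0 = 0" using assms by simp
  have "(1 + fps_X) * fps_deriv (fps_binomial b) = fps_const b * fps_binomial b"
    unfolding fps_binomial_deriv by (simp add: fps_divide_unit inverse_mult_eq_1' mult.left_commute)
  from arg_cong[OF this, of "\<lambda>v. v oo (u - 1)"]
  have "u * (fps_deriv (fps_binomial b) oo (u - 1)) = fps_const b * fps_real_power u b"
    using u0 by (simp add: fps_compose_mult_distrib fps_compose_add_distrib fps_real_power_def)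
  moreover have "fps_deriv (fps_real_power u b) = (fps_deriv (fps_binomial b) oo (u - 1)) * fps_deriv u"
    unfolding fps_real_power_def by (subst fps_compose_deriv[OF u0]) simp
  ultimately show ?thesis by (simp add: mult_ac)
qed

lemma fps_exp_of_ODE: "fps_deriv (fps_exp_of e) = fps_deriv e * fps_exp_of e"
  by (simp add: fps_exp_of_def fps_compose_deriv mult_ac)

definition compose_factor :: "real \<Rightarrow> real \<Rightarrow> real fps \<Rightarrow> real fps" where
  "compose_factor \<alpha> \<beta> g = fps_real_power (fps_X / g) \<beta>
     * fps_exp_of ((g - fps_X) / (fps_const \<alpha> * fps_X * g))"

text \<open>Here u = x / g, P = u^\<beta>, E = exp e, and the exponent is e = 1 / (\<alpha> x) - 1 /
  (\<alpha> g). The assumptions are the logarithmic derivatives of these, cleared of denominators;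
  the extra factor \<open>u\<close> is cancelled at the end.\<close>

lemma compose_factor_ODE_ring:
  fixes A B X g g' u u' e' P P' E E' :: "'a :: idom"
  assumes "u * g = X" "u' * g + u * g' = 1" "A * X * X * g * g * e' = X * X * g' - g * g"
    and "u * P' = B * u' * P" "E' = e' * E" "u \<noteq> 0"
  shows "A * X * X * g * g * (P * E' + P' * E)
      = (X * X * g' * (1 - A * B * g) - g * g * (1 - A * B * X)) * (P * E)"
proof -
  have "X * X * g * g * u' = (u * g) * X * g * g * u'" by (simp add: assms(1))
  also have "\<dots> = u * X * g * g * (u' * g + u * g') - u * X * g * (u * g) * g'"
    by (simp add: algebra_simps)
  finally have "X * X * g * g * u' = u * X * g * g * 1 - u * X * g * X * g'"
    by (simp only: assms(1,2))
  then have u': "X * X * g * g * u' = u * X * g * g - u * X * X * g * g'"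
    by (simp add: mult_ac)
  have "u * (A * X * X * g * g * (P * E' + P' * E))
      = u * P * E * (A * X * X * g * g * e') + A * X * X * g * g * (u * P') * E"
    by (simp add: assms(5) algebra_simps)
  also have "\<dots> = u * P * E * (X * X * g' - g * g) + A * B * P * E * (X * X * g * g * u')"
    unfolding assms(3,4) by (simp add: mult_ac)
  also have "\<dots> = u * ((X * X * g' * (1 - A * B * g) - g * g * (1 - A * B * X)) * (P * E))"
    unfolding u' by (simp add: algebra_simps)
  finally have "u * (A * X * X * g * g * (P * E' + P' * E))
      = u * ((X * X * g' * (1 - A * B * g) - g * g * (1 - A * B * X)) * (P * E))" .
  then show ?thesis using assms(6) by simp
qed

lemma compose_factor_ODE:
  assumes \<alpha>: "\<alpha> > 0" and g: "g $ 0 = 0" "g $ Suc 0 = 1"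
  shows "fps_const \<alpha> * fps_X * fps_X * g * g * fps_deriv (compose_factor \<alpha> \<beta> g)
    = (fps_X * fps_X * fps_deriv g * (1 - fps_const \<alpha> * fps_const \<beta> * g)
        - g * g * (1 - fps_const \<alpha> * fps_const \<beta> * fps_X)) * compose_factor \<alpha> \<beta> g"
    and "compose_factor \<alpha> \<beta> g $ 0 = exp (g $ 2 / \<alpha>)"
proof -
  define u where "u = fps_X / g"
  define e where "e = (g - fps_X) / (fps_const \<alpha> * fps_X * g)"
  \<comment> \<open>Both quotients are first shown to be exact, by divisibility, so that they can be
    replaced by the equations \<open>u\<close> and \<open>e\<close> and differentiated as
    products.\<close>
  obtain g1 where g1: "g = fps_X * g1" using g(1) fps_X_power_dvd_iff_nth[of 1 g] by auto
  have "g1 $ 0 = 1" using g(2) by (simp add: g1)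
  then have g1i: "g1 * inverse g1 = 1" by (simp add: inverse_mult_eq_1')
  have "fps_X = g * inverse g1" by (simp add: g1 g1i mult.assoc)
  then have u: "u * g = fps_X" unfolding u_def by (intro dvd_div_mult_self dvdI)
  have "fps_X ^ 2 dvd g - fps_X"
    unfolding fps_X_power_dvd_iff_nth using g by (auto simp: less_Suc_eq numeral_2_eq_2)
  then obtain q where q: "g - fps_X = fps_X ^ 2 * q" by blast
  have "(fps_const \<alpha> * fps_X * g) * (fps_const (1 / \<alpha>) * inverse g1 * q)
      = (fps_const \<alpha> * fps_const (1 / \<alpha>)) * fps_X ^ 2 * q * (g1 * inverse g1)"
    by (simp add: g1 power2_eq_square mult_ac del: fps_const_mult)
  also have "\<dots> = g - fps_X" using \<alpha> by (simp add: g1i q)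
  finally have "fps_const \<alpha> * fps_X * g dvd g - fps_X" by (metis dvd_triv_left)
  then have e: "e * (fps_const \<alpha> * fps_X * g) = g - fps_X"
    unfolding e_def by (rule dvd_div_mult_self)
  have u0: "u $ 0 = 1" using arg_cong[OF u, of "\<lambda>f. f $ Suc 0"] g by (simp add: fps_mult_nth)
  have e0: "e $ 0 = g $ 2 / \<alpha>"
  proof -
    have "(fps_X * (fps_const \<alpha> * (e * g))) $ 2 = (g - fps_X) $ 2" using e by (simp add: mult_ac)
    then have "\<alpha> * (e $ 0) = g $ 2" using g by (simp add: numeral_2_eq_2 fps_mult_nth)
    then show ?thesis using \<alpha> by (simp add: field_simps)
  qed
  define A where "A = fps_const \<alpha>"
  have u': "fps_deriv u * g + u * fps_deriv g = 1"
    using arg_cong[OF u, of fps_deriv] by (simp add: algebra_simps)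
  have e'0: "fps_deriv e * (A * fps_X * g) + e * (A * (g + fps_X * fps_deriv g)) = fps_deriv g - 1"
    using arg_cong[OF e, of fps_deriv] by (simp add: A_def algebra_simps)
  have e': "A * fps_X * fps_X * g * g * fps_deriv e = fps_X * fps_X * fps_deriv g - g * g"
  proof -
    have "A * fps_X * fps_X * g * g * fps_deriv e - (fps_X * fps_X * fps_deriv g - g * g)
        = fps_X * g * ((fps_deriv e * (A * fps_X * g) + e * (A * (g + fps_X * fps_deriv g))) - (fps_deriv g - 1))
          - (g + fps_X * fps_deriv g) * (e * (A * fps_X * g) - (g - fps_X))"
      by (simp add: algebra_simps)
    also have "\<dots> = 0" unfolding e'0 by (simp add: e[folded A_def])
    finally show ?thesis by simp
  qed
  have "u \<noteq> 0" using u0 by auto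
  from compose_factor_ODE_ring[OF u u' e' fps_real_power_ODE[OF u0] fps_exp_of_ODE[of e] this]
  show "fps_const \<alpha> * fps_X * fps_X * g * g * fps_deriv (compose_factor \<alpha> \<beta> g)
    = (fps_X * fps_X * fps_deriv g * (1 - fps_const \<alpha> * fps_const \<beta> * g)
        - g * g * (1 - fps_const \<alpha> * fps_const \<beta> * fps_X)) * compose_factor \<alpha> \<beta> g"
    by (simp add: compose_factor_def u_def e_def A_def)
  show "compose_factor \<alpha> \<beta> g $ 0 = exp (g $ 2 / \<alpha>)"
    unfolding compose_factor_def u_def[symmetric] e_def[symmetric] using e0
    by (simp add: fps_real_power_def fps_exp_of_def)
qed

text \<open>The coefficient of \<open>c oo g\<close> given by the reduction to G and the closed form
  satisfy the same linear equation with the same nonzero constant term, hence agree.\<close>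

theorem fact_asymp_compose:
  assumes pos: "\<alpha> > 0" "\<beta> > 0" and g: "g $ 0 = 0" "g $ Suc 0 = 1" "fact_asymp \<alpha> \<beta> g H"
    and f: "fact_asymp \<alpha> \<beta> f c"
  shows "fact_asymp \<alpha> \<beta> (f oo g) ((fps_deriv f oo g) * H + compose_factor \<alpha> \<beta> g * (c oo g))"
proof -
  let ?G = "wt_base \<alpha> \<beta>"
  obtain Y where Y: "fact_asymp \<alpha> \<beta> (?G oo g) Y"
    "(Y - (fps_deriv ?G oo g) * H) $ 0 = exp (g $ 2 / \<alpha>)"
    using fact_asymp_base_compose_tangent(1)[OF pos g] by blast
  have "g \<noteq> 0" using g(2) by auto
  then have "fps_const \<alpha> * fps_X * fps_X * g * g \<noteq> 0" using pos by simp
  then have "Y - (fps_deriv ?G oo g) * H = compose_factor \<alpha> \<beta> g"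
    using Y(2) compose_factor_ODE(2)[OF pos(1) g(1,2), of \<beta>]
    by (intro fps_linear_ODE_unique[OF base_compose_ODE[OF pos g(1,3) Y(1)] compose_factor_ODE(1)[OF pos(1) g(1,2)]])
      simp_all
  with fact_asymp_compose_via_base[OF pos g(1,3) fact_asymp_base_compose_tangent(2)[OF pos g] Y(1) f]
  show ?thesis by simp
qed

section \<open>Compositional inverses\<close>

lemma fps_inv_tangent:
  assumes "(g :: real fps) $ 0 = 0" "g $ Suc 0 = 1"
  shows "fps_inv g oo g = fps_X" "g oo fps_inv g = fps_X" "fps_inv g $ 0 = 0" "fps_inv g $ Suc 0 = 1"
proof -
  show 1: "fps_inv g oo g = fps_X" and "g oo fps_inv g = fps_X"
    using fps_inv[of g] fps_inv_right[of g] assms by simp_all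
  show "fps_inv g $ 0 = 0" by (simp add: fps_inv_def)
  show "fps_inv g $ Suc 0 = 1"
    using arg_cong[OF 1, of "\<lambda>f. f $ Suc 0"] assms by (simp add: fps_compose_nth_1)
qed

lemma fps_inv_unique:
  assumes g: "(g :: real fps) $ 0 = 0" "g $ Suc 0 = 1" and r: "r $ 0 = 0" "g oo r = fps_X"
  shows "fps_inv g = r"
proof -
  have "fps_inv g = fps_inv g oo (g oo r)" by (simp add: r)
  also have "\<dots> = (fps_inv g oo g) oo r" by (rule fps_compose_assoc[OF r(1) g(1)])
  also have "\<dots> = r" using r(1) by (simp add: fps_inv_tangent(1)[OF g])
  finally show ?thesis .
qed

text \<open>The chain rule predicts the expansion of the inverse \<open>k\<close>. The difference
  between \<open>k\<close> and its predicted truncation becomes small after substituting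
  \<open>h\<close>, and substituting \<open>k\<close> carries this back.\<close>

lemma fact_asymp_inverse_tangent2:
  assumes pos: "\<alpha> > 0" "\<beta> > 0" and h: "h $ 0 = 0" "h $ Suc 0 = 1" "h $ 2 = 0" "fact_asymp \<alpha> \<beta> h H"
  shows "\<exists>c. fact_asymp \<alpha> \<beta> (fps_inv h) c"
proof -
  let ?G = "wt_base \<alpha> \<beta>"
  define k where "k = fps_inv h"
  define J where "J = compose_factor \<alpha> \<beta> h"
  have k: "k oo h = fps_X" "h oo k = fps_X" "k $ 0 = 0" "k $ Suc 0 = 1"
    unfolding k_def using fps_inv_tangent[OF h(1,2)] by auto
  have k2: "k $ 2 = 0"
    using fps_compose_nth_2[OF h(1), of k] h k by simp
  have fps_X_bounded: "fps_X \<in> wt_bounded \<alpha> \<beta>"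
    using fact_asymp_bounded[OF fact_asymp_finite[OF pos fps_finite_X]] .
  obtain \<delta> where \<delta>: "h = fps_X + \<delta>" "fps_X ^ 3 dvd \<delta>" using tangent_eq_X_plus[OF h(1-3)] .
  obtain \<epsilon> where \<epsilon>: "k = fps_X + \<epsilon>" "fps_X ^ 3 dvd \<epsilon>" using tangent_eq_X_plus[OF k(3,4) k2] .
  have "\<delta> \<in> wt_bounded \<alpha> \<beta>"
    using wt_bounded_diff[OF fact_asymp_bounded[OF h(4)] fps_X_bounded] by (simp add: \<delta>(1))
  then have kB: "k \<in> wt_bounded \<alpha> \<beta>"
    using compose_inverse_tangent2_bounded[OF pos _ \<delta>(2) k(1)[unfolded \<delta>(1)] k(3,4)] by blast
  have "\<epsilon> \<in> wt_bounded \<alpha> \<beta>"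
    using wt_bounded_diff[OF kB fps_X_bounded] by (simp add: \<epsilon>(1))
  then have "\<epsilon> \<in> wt_bounded \<alpha> (\<beta> + 1)" using wt_bounded_mono[OF pos, of 1] by auto
  then have comp_k: "f oo k \<in> wt_bounded \<alpha> (\<beta> + 1)" if "f \<in> wt_bounded \<alpha> (\<beta> + 1)" for f
    unfolding \<epsilon>(1) using pos \<epsilon>(2) that by (intro wt_bounded_compose_tangent2) auto
  have "J $ 0 \<noteq> 0" unfolding J_def by (simp add: compose_factor_ODE(2)[OF pos(1) h(1,2)])
  then have JI: "J * inverse J = 1" by (simp add: inverse_mult_eq_1')
  \<comment> \<open>This is the solution of (k' o h) H + J (c o h) = 0, which the chain rule for k o
    h = x demands.\<close>
  define c where "c = (- (fps_deriv k oo h) * H * inverse J) oo k"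
  have "c oo h = - (fps_deriv k oo h) * H * inverse J"
    unfolding c_def using k h(1) by (simp flip: fps_compose_assoc)
  then have "J * (c oo h) = - (fps_deriv k oo h) * H * (J * inverse J)" by (simp only: mult_ac)
  then have Jc: "J * (c oo h) = - (fps_deriv k oo h) * H" by (simp add: JI)
  have "fact_asymp \<alpha> \<beta> k c"
    unfolding fact_asymp_def
  proof
    fix R
    define p where "p = fps_cutoff R c"
    define s where "s = fps_cutoff (Suc R) (k - p * ?G)"
    define u where "u = k - (p * ?G + s)"
    define e where "e = (fps_deriv (p * ?G + s) oo h) * H + J * (p oo h)"
    have u: "fps_X ^ Suc R dvd u"
      unfolding fps_X_power_dvd_iff_nth u_def s_def by simp
    have p_asymp: "fact_asymp \<alpha> \<beta> (p * ?G + s) (p * 1 + 0)"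
      by (intro fact_asymp_add fact_asymp_finite_mult fact_asymp_base fact_asymp_finite pos)
        (simp_all add: p_def s_def)
    have "fact_asymp \<alpha> \<beta> ((p * ?G + s) oo h) e"
      using fact_asymp_compose[OF pos h(1,2,4) p_asymp] unfolding e_def J_def mult_1_right add_0_right .
    then have "fact_asymp \<alpha> \<beta> (fps_X - ((p * ?G + s) oo h)) (0 - e)"
      by (intro fact_asymp_diff fact_asymp_finite pos fps_finite_X)
    also have "fps_X - ((p * ?G + s) oo h) = u oo h"
      by (simp add: u_def fps_compose_sub_distrib k(1))
    finally have uh: "fact_asymp \<alpha> \<beta> (u oo h) (- e)" by simp
    have "fps_deriv (p * ?G + s) = fps_deriv k - fps_deriv u" by (simp add: u_def)
    then have "e = ((fps_deriv k oo h) * H + J * (p oo h)) - (fps_deriv u oo h) * H"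
      unfolding e_def by (simp add: fps_compose_sub_distrib left_diff_distrib)
    also have "(fps_deriv k oo h) * H + J * (p oo h) = J * ((p - c) oo h)"
      by (simp add: fps_compose_sub_distrib right_diff_distrib Jc)
    also have "fps_X ^ R dvd J * ((p - c) oo h) - (fps_deriv u oo h) * H"
      unfolding p_def by (intro dvd_diff dvd_mult dvd_mult2 fps_X_power_dvd_compose h(1)
          fps_X_power_dvd_cutoff_diff fps_X_power_dvd_deriv u)
    finally have "fps_X ^ R dvd e" .
    \<comment> \<open>The choice of \<open>c\<close> makes the first \<open>R\<close> coefficients
      of the expansion vanish, so u o h itself lies in the remainder space.\<close>
    then have "fps_cutoff R (- e) = 0" by (simp add: fps_eq_iff fps_X_power_dvd_iff_nth)
    then have "u oo h \<in> wt_small \<alpha> \<beta> R" using fact_asympD[OF uh, of R] by simp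
    then have "(u oo h) oo k \<in> wt_small \<alpha> \<beta> R"
      by (intro wt_small_compose[OF pos k(3) kB comp_k] fps_X_power_dvd_compose h(1) u)
    also have "(u oo h) oo k = u" using k h(1) by (simp flip: fps_compose_assoc)
    finally have "u + s \<in> wt_small \<alpha> \<beta> R"
      by (rule wt_small_add[OF _ wt_small_finite[OF pos]]) (simp add: s_def)
    then show "k - fps_cutoff R c * ?G \<in> wt_small \<alpha> \<beta> R" by (simp add: u_def p_def)
  qed
  then show ?thesis unfolding k_def by blast
qed

text \<open>Existence of an expansion comes from writing the inverse as a Moebius series composed
  with the inverse of \<open>h\<close>. The formula is then forced: g o g^(-1) = x has expansion 0,
  and the chain rule is solved for the unknown expansion.\<close>

theorem fact_asymp_inverse:
  assumes pos: "\<alpha> > 0" "\<beta> > 0" and g: "g $ 0 = 0" "g $ Suc 0 = 1" "fact_asymp \<alpha> \<beta> g H"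
  shows "fact_asymp \<alpha> \<beta> (fps_inv g)
    (- fps_deriv (fps_inv g) * compose_factor \<alpha> \<beta> (fps_inv g) * (H oo fps_inv g))"
proof -
  let ?a = "g $ 2" and ?k = "fps_inv g"
  obtain h where h: "h = g oo moebius_fps (- ?a)" "g = h oo moebius_fps ?a"
    "h $ 0 = 0" "h $ Suc 0 = 1" "h $ 2 = 0"
    using tangent_moebius_decomposition[OF g(1,2)] .
  obtain Hh where "fact_asymp \<alpha> \<beta> h Hh"
    using fact_asymp_compose_moebius[OF pos g(3)] unfolding h(1) by blast
  then obtain d where d: "fact_asymp \<alpha> \<beta> (fps_inv h) d"
    using fact_asymp_inverse_tangent2[OF pos h(3-5)] by blast
  note hi = fps_inv_tangent[OF h(3,4)] and gi = fps_inv_tangent[OF g(1,2)]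
  let ?r = "moebius_fps (- ?a) oo fps_inv h"
  have "g oo ?r = (g oo moebius_fps (- ?a)) oo fps_inv h"
    by (rule fps_compose_assoc) (simp_all add: hi)
  then have "g oo ?r = fps_X" by (simp add: hi flip: h(1))
  then have k: "?k = ?r" by (intro fps_inv_unique g) simp_all
  obtain K where K: "fact_asymp \<alpha> \<beta> ?k K"
    using fact_asymp_compose[OF pos hi(3,4) d fact_asymp_moebius[OF pos]] unfolding k by blast
  have "fact_asymp \<alpha> \<beta> (g oo ?k) ((fps_deriv g oo ?k) * K + compose_factor \<alpha> \<beta> ?k * (H oo ?k))"
    by (rule fact_asymp_compose[OF pos gi(3,4) K g(3)])
  moreover have "fact_asymp \<alpha> \<beta> (g oo ?k) 0"
    unfolding gi(2) by (intro fact_asymp_finite pos fps_finite_X)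
  ultimately have "(fps_deriv g oo ?k) * K + compose_factor \<alpha> \<beta> ?k * (H oo ?k) = 0"
    by (rule fact_asymp_unique[OF pos])
  then have "(fps_deriv g oo ?k) * K = - (compose_factor \<alpha> \<beta> ?k * (H oo ?k))"
    by (simp only: eq_neg_iff_add_eq_0)
  then have "fps_deriv ?k * ((fps_deriv g oo ?k) * K) = fps_deriv ?k * (- (compose_factor \<alpha> \<beta> ?k * (H oo ?k)))"
    by (rule arg_cong)
  moreover have "(fps_deriv g oo ?k) * fps_deriv ?k = 1"
    using fps_compose_deriv[OF gi(3), of g] by (simp add: gi(2))
  then have "fps_deriv ?k * ((fps_deriv g oo ?k) * K) = K"
    by (metis mult.assoc mult.commute mult.left_neutral)
  ultimately have "K = - fps_deriv ?k * compose_factor \<alpha> \<beta> ?k * (H oo ?k)"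
    by (simp add: mult.assoc)
  with K show ?thesis by simp
qed

section \<open>The group of formal diffeomorphisms\<close>

lemma group_tangent_id_diffeos: "group tangent_id_diffeos"
proof (rule groupI)
  fix x y z assume "x \<in> carrier tangent_id_diffeos" "y \<in> carrier tangent_id_diffeos"
    "z \<in> carrier tangent_id_diffeos"
  then show "x \<otimes>\<^bsub>tangent_id_diffeos\<^esub> y \<otimes>\<^bsub>tangent_id_diffeos\<^esub> z
      = x \<otimes>\<^bsub>tangent_id_diffeos\<^esub> (y \<otimes>\<^bsub>tangent_id_diffeos\<^esub> z)"
    by (simp add: tangent_id_diffeos_def fps_compose_assoc)
next
  fix x assume "x \<in> carrier tangent_id_diffeos"
  then have x: "x $ 0 = 0" "x $ Suc 0 = 1" by (simp_all add: tangent_id_diffeos_def)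
  show "\<exists>y\<in>carrier tangent_id_diffeos. y \<otimes>\<^bsub>tangent_id_diffeos\<^esub> x = \<one>\<^bsub>tangent_id_diffeos\<^esub>"
    using fps_inv_tangent[OF x] by (intro bexI[of _ "fps_inv x"]) (simp_all add: tangent_id_diffeos_def)
qed (auto simp: tangent_id_diffeos_def fps_compose_nth_1)

lemma inv_tangent_id_diffeos:
  assumes "x $ 0 = 0" "x $ Suc 0 = 1"
  shows "inv\<^bsub>tangent_id_diffeos\<^esub> x = fps_inv x"
  using fps_inv_tangent[OF assms] assms
  by (intro group.inv_equality[OF group_tangent_id_diffeos]) (simp_all add: tangent_id_diffeos_def)

theorem mainTheorem1:
  fixes \<alpha> \<beta> :: real
  assumes "\<alpha> > 0" and "\<beta> > 0"
  shows "group tangent_id_diffeos \<and>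
    subgroup {f \<in> fact_div_fps \<alpha> \<beta>. f $ 0 = 0 \<and> f $ 1 = 1} tangent_id_diffeos \<and>
    (\<forall>f \<in> fact_div_fps \<alpha> \<beta>. \<forall>g \<in> fact_div_fps \<alpha> \<beta>. g $ 0 = 0 \<and> g $ 1 = 1 \<longrightarrow>
      f oo g \<in> fact_div_fps \<alpha> \<beta> \<and>
      fps_inv g \<in> fact_div_fps \<alpha> \<beta> \<and>
      asymp_deriv \<alpha> \<beta> (f oo g) =
        (fps_deriv f oo g) * asymp_deriv \<alpha> \<beta> g
        + fps_real_power (fps_X / g) \<beta>
          * fps_exp_of ((g - fps_X) / (fps_const \<alpha> * fps_X * g))
          * (asymp_deriv \<alpha> \<beta> f oo g) \<and>
      asymp_deriv \<alpha> \<beta> (fps_inv g) =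
        - fps_deriv (fps_inv g)
        * fps_real_power (fps_X / fps_inv g) \<beta>
        * fps_exp_of ((fps_inv g - fps_X) / (fps_const \<alpha> * fps_X * fps_inv g))
        * (asymp_deriv \<alpha> \<beta> g oo fps_inv g))"
proof (intro conjI ballI impI)
  note mem = fact_div_fps_iff[OF assms] and ad = asymp_deriv_eq[OF assms]
  have comp: "f oo g \<in> fact_div_fps \<alpha> \<beta>" "fps_inv g \<in> fact_div_fps \<alpha> \<beta>"
    "asymp_deriv \<alpha> \<beta> (f oo g)
      = (fps_deriv f oo g) * asymp_deriv \<alpha> \<beta> g + compose_factor \<alpha> \<beta> g * (asymp_deriv \<alpha> \<beta> f oo g)"
    "asymp_deriv \<alpha> \<beta> (fps_inv g)
      = - fps_deriv (fps_inv g) * compose_factor \<alpha> \<beta> (fps_inv g) * (asymp_deriv \<alpha> \<beta> g oo fps_inv g)"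
    if fg: "f \<in> fact_div_fps \<alpha> \<beta>" "g \<in> fact_div_fps \<alpha> \<beta>" and "g $ 0 = 0 \<and> g $ 1 = 1" for f g
  proof -
    have g: "g $ 0 = 0" "g $ Suc 0 = 1" using that by simp_all
    obtain c H where c: "fact_asymp \<alpha> \<beta> f c" and H: "fact_asymp \<alpha> \<beta> g H" using fg mem by blast
    note 1 = fact_asymp_compose[OF assms g H c] and 2 = fact_asymp_inverse[OF assms g H]
    show "f oo g \<in> fact_div_fps \<alpha> \<beta>" "fps_inv g \<in> fact_div_fps \<alpha> \<beta>" using 1 2 mem by blast+
    show "asymp_deriv \<alpha> \<beta> (f oo g)
      = (fps_deriv f oo g) * asymp_deriv \<alpha> \<beta> g + compose_factor \<alpha> \<beta> g * (asymp_deriv \<alpha> \<beta> f oo g)"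
      by (simp only: ad[OF 1] ad[OF c] ad[OF H])
    show "asymp_deriv \<alpha> \<beta> (fps_inv g)
      = - fps_deriv (fps_inv g) * compose_factor \<alpha> \<beta> (fps_inv g) * (asymp_deriv \<alpha> \<beta> g oo fps_inv g)"
      by (simp only: ad[OF 2] ad[OF H])
  qed
  show grp: "group tangent_id_diffeos" by (rule group_tangent_id_diffeos)
  show "subgroup {f \<in> fact_div_fps \<alpha> \<beta>. f $ 0 = 0 \<and> f $ 1 = 1} tangent_id_diffeos" (is "subgroup ?H _")
  proof (rule group.subgroupI[OF grp])
    show "?H \<subseteq> carrier tangent_id_diffeos" by (auto simp: tangent_id_diffeos_def)
    have "fps_X \<in> ?H" using fact_asymp_finite[OF assms fps_finite_X] mem by auto
    then show "?H \<noteq> {}" by blast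
    fix a assume a: "a \<in> ?H"
    \<comment> \<open>The claim about the inverse concerns only the second series, so
      \<open>a\<close> also fills the place of the first.\<close>
    then show "inv\<^bsub>tangent_id_diffeos\<^esub> a \<in> ?H"
      using comp(2)[of a a] fps_inv_tangent[of a] by (auto simp: inv_tangent_id_diffeos)
    fix b assume "b \<in> ?H"
    then show "a \<otimes>\<^bsub>tangent_id_diffeos\<^esub> b \<in> ?H"
      using a comp(1)[of a b] by (auto simp: tangent_id_diffeos_def fps_compose_nth_1)
  qed
  fix f g assume fg: "f \<in> fact_div_fps \<alpha> \<beta>" "g \<in> fact_div_fps \<alpha> \<beta>" "g $ 0 = 0 \<and> g $ 1 = 1"
  show "f oo g \<in> fact_div_fps \<alpha> \<beta>" "fps_inv g \<in> fact_div_fps \<alpha> \<beta>"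
    using comp(1,2)[OF fg] by auto
  show "asymp_deriv \<alpha> \<beta> (f oo g) =
        (fps_deriv f oo g) * asymp_deriv \<alpha> \<beta> g
        + fps_real_power (fps_X / g) \<beta>
          * fps_exp_of ((g - fps_X) / (fps_const \<alpha> * fps_X * g))
          * (asymp_deriv \<alpha> \<beta> f oo g)"
    unfolding comp(3)[OF fg] compose_factor_def ..
  show "asymp_deriv \<alpha> \<beta> (fps_inv g) =
        - fps_deriv (fps_inv g)
        * fps_real_power (fps_X / fps_inv g) \<beta>
        * fps_exp_of ((fps_inv g - fps_X) / (fps_const \<alpha> * fps_X * fps_inv g))
        * (asymp_deriv \<alpha> \<beta> g oo fps_inv g)"
    unfolding comp(4)[OF fg] compose_factor_def mult.assoc ..
qed

end
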